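(* Let $u_h$ be the reference finite element solution and let $u_{\mathrm{ms}}$ be the solution of the (ideal, non-localized) generalized finite element method, both defined in the context. Then $$\|u_h-u_{\mathrm{ms}}\|_{H^1(\Omega)}\le CH\alpha^{-1}\|f\|_{L_2(\Omega)},$$ where $C$ depends on $C_{\mathrm{ko}}$ and $C_\rho$.
   Context: **Elasticity problem.** Let $d\in\{2,3\}$ and let $\Omega\subseteq\mathbb R^d$ be a bounded polygonal (polyhedral) Lipschitz domain. Its boundary is the disjoint union $\partial\Omega=\Gamma_D\cup\Gamma_N$ of Hausdorff measurable parts with $\mathrm{meas}(\Gamma_D)>0$. The data $d,\Omega,\Gamma_D,\Gamma_N$ are fixed. Let $\mathbb S$ be the space of symmetric $d\times d$ matrices and $A:B=\sum_{i,j}A_{ij}B_{ij}$. The tensor $A=(A_{ijkl})$ has entries in $L_\infty(\Omega)$, satisfies $A_{ijkl}=A_{jikl}=A_{ijlk}=A_{klij}$ a.e., and there are constants $\alpha,\beta>0$ with $\alpha B:B\le A(x)B:B\le\beta B:B$ for all $B\in\mathbb S$ and a.e. $x\in\Omega$. Data: $f\in L_2(\Omega,\mathbb R^d)$, $b\in L_2(\Gamma_N,\mathbb R^d)$, $g\in H^{1/2}(\Gamma_D,\mathbb R^d)$. Let $\gamma$ be the trace onto $\Gamma_D$, $V=\{v\in (H^1(\Omega))^d:\gamma v=0\}$, $\varepsilon_{kl}(v)=\frac12(\partial_kv_l+\partial_lv_k)$, $\mathcal B(v,w)=\int_\Omega A\varepsilon(v):\varepsilon(w)\,dx$. $\|v\|_{H^1(\Omega)}^2=\|v\|^2_{L_2(\Omega)}+\|\nabla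 v\|_{L_2(\Omega)}^2$. $C_{\mathrm{ko}}$ is the constant in Korn's inequality $\|\nabla v\|_{L_2(\Omega)}\le C_{\mathrm{ko}}\|\varepsilon(v)\|_{L_2(\Omega)}$, $v\in V$. **Meshes and spaces.** $\mathcal T_h$ is a regular triangulation of $\Omega$ into closed triangles/tetrahedra with maximal diameter $h$, from a shape regular family; $S_h$ is the space of continuous $\mathbb R^d$-valued functions on $\bar\Omega$ that are componentwise affine on each $T\in\mathcal T_h$; $V_h=S_h\cap V$. $\mathcal T_H$ is a coarser triangulation with maximal diameter $H>h$, from a shape regular and quasi-uniform family, such that $\mathcal T_h$ is a refinement of $\mathcal T_H$; $V_H\subseteq V_h$ is the analogous space for $\mathcal T_H$. **Interpolation.** $I_H:V_h\to V_H$ is a linear operator with $I_H\circ I_H=I_H$ and $$H_T^{-1}\|v-I_Hv\|_{L_2(T)}+\|\nabla I_Hv\|_{L_2(T)}\le C_I\|\nabla v\|_{L_2(\omega_T)}\quad\forall T\in\mathcal T_H,\ v\in V_h,$$ where $H_T=\mathrm{diam}(T)$ and $\omega_T=\bigcup\{\hat T\in\mathcal T_H:\hat T\cap T\ne\emptyset\}$. Consequently there is a constant $C_\rho$, depending on $C_I$ and the shape regularity of $\mathcal T_H$, with $$H^{-1}\|v-I_Hv\|_{L_2(\Omega)}+\|\nabla I_Hv\|_{L_2(\Omega)}\le C_\rho\|\nabla v\|_{L_2(\Omega)}\quad\forall v\in V_h.$$ Set $V_{\mathrm f}=\ker I_H\subseteq V_h$. **Reference solution.** $g_h\in S_h$ approximates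 an extension of $g$, vanishes at all nodes of $\mathcal T_h$ not on $\Gamma_D$, and $\gamma g_h$ is some approximation of $g$. $u_h=u_{h,0}+g_h$ with $u_{h,0}\in V_h$ satisfying $$\mathcal B(u_{h,0},v)=(f,v)_{L_2(\Omega)}+(b,v)_{L_2(\Gamma_N)}-\mathcal B(g_h,v)\quad\forall v\in V_h.$$ **Ideal method.** For $v\in S_h$ (in particular $v\in V_h$ or $v=g_h$), $R_{\mathrm f}v\in V_{\mathrm f}$ is defined by $\mathcal B(R_{\mathrm f}v,w)=\mathcal B(v,w)$ for all $w\in V_{\mathrm f}$. The multiscale space is $V_{\mathrm{ms}}=\{v_H-R_{\mathrm f}v_H:v_H\in V_H\}$. The Neumann corrector $\tilde b_{\mathrm f}\in V_{\mathrm f}$ is defined by $\mathcal B(\tilde b_{\mathrm f},w)=(b,w)_{L_2(\Gamma_N)}$ for all $w\in V_{\mathrm f}$. Finally $u_{\mathrm{ms}}=u_{0,\mathrm{ms}}+\tilde b_{\mathrm f}+g_h-R_{\mathrm f}g_h$, where $u_{0,\mathrm{ms}}\in V_{\mathrm{ms}}$ satisfies $$\mathcal B(u_{0,\mathrm{ms}},v)=(f,v)_{L_2(\Omega)}+(b,v)_{L_2(\Gamma_N)}-\mathcal B(\tilde b_{\mathrm f}+g_h-R_{\mathrm f}g_h,v)\quad\forall v\in V_{\mathrm{ms}}.$$ *)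

theory Defs
  imports "HOL-Analysis.Analysis"
begin

section \<open>Hausdorff measure\<close>

text \<open>
  The factor \<open>unit_ball_vol s / 2 ^ s\<close> normalises the measure so that in integer dimension it
  agrees with surface area.
\<close>

definition hausdorff_weight :: "nat \<Rightarrow> 'a::metric_space set \<Rightarrow> ennreal" where
  "hausdorff_weight s U =
     (if U = {} then 0 else ennreal (unit_ball_vol (real s) / 2 ^ s * diameter U ^ s))"

definition hausdorff_pre :: "nat \<Rightarrow> real \<Rightarrow> 'a::metric_space set \<Rightarrow> ennreal" where
  "hausdorff_pre s \<delta> E =
     (INF U\<in>{U :: nat \<Rightarrow> 'a set. E \<subseteq> (\<Union>i. U i) \<and> (\<forall>i. bounded (U i) \<and> diameter (U i) \<le> \<delta>)}.
        \<Sum>i. hausdorff_weight s (U i))"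

definition hausdorff_outer :: "nat \<Rightarrow> 'a::metric_space set \<Rightarrow> ennreal" where
  "hausdorff_outer s E = (SUP \<delta>\<in>{0<..}. hausdorff_pre s \<delta> E)"

definition hausdorff_measure :: "nat \<Rightarrow> 'a::metric_space measure" where
  "hausdorff_measure s =
     measure_of UNIV (lambda_system UNIV UNIV (hausdorff_outer s)) (hausdorff_outer s)"

text \<open>
  Since \<^const>\<open>measure_of\<close> yields the zero measure unless it is given a measure space, we
  check that the construction is the intended one.
\<close>

lemma hausdorff_pre_empty: "hausdorff_pre s \<delta> ({} :: 'a::metric_space set) = 0" if "\<delta> > 0"
proof -
  have "hausdorff_pre s \<delta> ({} :: 'a set) \<le> (\<Sum>i::nat. hausdorff_weight s ({} :: 'a set))"
    unfolding hausdorff_pre_def using that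
    by (intro INF_lower2[of "\<lambda>_. {}"]) (auto simp: diameter_def)
  then show ?thesis by (simp add: hausdorff_weight_def)
qed

lemma hausdorff_pre_mono: "A \<subseteq> B \<Longrightarrow> hausdorff_pre s \<delta> A \<le> hausdorff_pre s \<delta> B"
  unfolding hausdorff_pre_def by (rule INF_superset_mono) auto

lemma hausdorff_pre_subadditive:
  "hausdorff_pre s \<delta> (\<Union>i. A i) \<le> (\<Sum>i. hausdorff_pre s \<delta> (A i))" for A :: "nat \<Rightarrow> 'a::metric_space set"
proof (rule ennreal_le_epsilon)
  fix e :: real
  assume e: "0 < e" and fin: "(\<Sum>n. hausdorff_pre s \<delta> (A n)) < top"
  have lt: "hausdorff_pre s \<delta> (A n) < hausdorff_pre s \<delta> (A n) + e * (1/2)^Suc n" for n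
    using e fin by (auto simp add: less_top dest!: ennreal_suminf_lessD)
  have "\<exists>U. A n \<subseteq> (\<Union>i. U i) \<and> (\<forall>i::nat. bounded (U i) \<and> diameter (U i) \<le> \<delta>) \<and>
           (\<Sum>i. hausdorff_weight s (U i)) \<le> hausdorff_pre s \<delta> (A n) + e * (1/2)^Suc n" for n
  proof -
    have "\<exists>U\<in>{U. A n \<subseteq> (\<Union>i. U i) \<and> (\<forall>i::nat. bounded (U i) \<and> diameter (U i) \<le> \<delta>)}.
        (\<Sum>i. hausdorff_weight s (U i)) < hausdorff_pre s \<delta> (A n) + e * (1/2)^Suc n"
      using lt[of n] by (subst (asm) (1) hausdorff_pre_def) (simp only: INF_less_iff)
    then show ?thesis by (auto intro: less_imp_le)
  qed
  then obtain B where B: "\<And>n. A n \<subseteq> (\<Union>i. B n i)"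
      "\<And>n i. bounded (B n i)" "\<And>n i. diameter (B n (i::nat)) \<le> \<delta>"
      "\<And>n. (\<Sum>i. hausdorff_weight s (B n i)) \<le> hausdorff_pre s \<delta> (A n) + e * (1/2)^Suc n"
    by metis
  define C where "C = case_prod B o prod_decode"
  have sub: "(\<Union>i. A i) \<subseteq> (\<Union>i. C i)"
    using B(1) by (auto simp add: C_def subset_eq) (metis prod.case prod_encode_inverse)
  have "hausdorff_pre s \<delta> (\<Union>i. A i) \<le> (\<Sum>i. hausdorff_weight s (C i))"
    unfolding hausdorff_pre_def[of s \<delta> "\<Union>i. A i"]
    using sub B(2,3) by (intro INF_lower) (auto simp: C_def split_def)
  also have "\<dots> = (\<Sum>n. \<Sum>i. hausdorff_weight s (B n i))"
    unfolding C_def comp_def using suminf_ennreal_2dimen[of "\<lambda>n. \<Sum>i. hausdorff_weight s (B n i)"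
      "\<lambda>(n,i). hausdorff_weight s (B n i)"] by (simp add: split_def)
  also have "\<dots> \<le> (\<Sum>n. hausdorff_pre s \<delta> (A n) + e * (1/2) ^ Suc n)"
    by (intro suminf_le allI B(4)) auto
  also have "\<dots> = (\<Sum>n. hausdorff_pre s \<delta> (A n)) + (\<Sum>n. ennreal e * ennreal ((1/2) ^ Suc n))"
    using e by (subst suminf_add[symmetric])
      (auto simp del: ennreal_suminf_cmult simp add: ennreal_mult[symmetric])
  also have "\<dots> = (\<Sum>n. hausdorff_pre s \<delta> (A n)) + e"
    unfolding ennreal_suminf_cmult
    by (subst suminf_ennreal_eq[OF zero_le_power power_half_series]) auto
  finally show "hausdorff_pre s \<delta> (\<Union>i. A i) \<le> (\<Sum>n. hausdorff_pre s \<delta> (A n)) + e" .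
qed

lemma hausdorff_outer_measure_space: "outer_measure_space UNIV (hausdorff_outer s)"
  unfolding outer_measure_space_def
proof (intro conjI)
  show "positive UNIV (hausdorff_outer s :: 'a set \<Rightarrow> _)"
    by (auto simp: positive_def hausdorff_outer_def hausdorff_pre_empty bot_ennreal intro!: antisym SUP_least)
  show "increasing UNIV (hausdorff_outer s :: 'a set \<Rightarrow> _)"
    unfolding increasing_def hausdorff_outer_def by (auto intro!: SUP_mono hausdorff_pre_mono)
  show "countably_subadditive UNIV (hausdorff_outer s :: 'a set \<Rightarrow> _)"
    unfolding countably_subadditive_def
  proof safe
    fix A :: "nat \<Rightarrow> 'a set"
    show "hausdorff_outer s (\<Union>i. A i) \<le> (\<Sum>i. hausdorff_outer s (A i))"
      unfolding hausdorff_outer_def[of s "\<Union>i. A i"]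
    proof (rule SUP_least)
      fix \<delta> :: real assume "\<delta> \<in> {0<..}"
      then have "hausdorff_pre s \<delta> (A i) \<le> hausdorff_outer s (A i)" for i
        unfolding hausdorff_outer_def by (rule SUP_upper)
      then have "(\<Sum>i. hausdorff_pre s \<delta> (A i)) \<le> (\<Sum>i. hausdorff_outer s (A i))"
        by (intro suminf_le) auto
      then show "hausdorff_pre s \<delta> (\<Union>i. A i) \<le> (\<Sum>i. hausdorff_outer s (A i))"
        using hausdorff_pre_subadditive order_trans by blast
    qed
  qed
qed

lemma hausdorff_measure_space:
  "measure_space UNIV (lambda_system UNIV UNIV (hausdorff_outer s)) (hausdorff_outer s)"
proof -
  interpret sigma_algebra UNIV "UNIV :: 'a set set"
    using sigma_algebra_Pow[of UNIV] by simp
  show ?thesis by (rule caratheodory_lemma[OF hausdorff_outer_measure_space])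
qed

lemma space_hausdorff_measure [simp]: "space (hausdorff_measure s) = UNIV"
  by (simp add: hausdorff_measure_def space_measure_of_conv)

lemma sets_hausdorff_measure:
  "sets (hausdorff_measure s) = lambda_system UNIV UNIV (hausdorff_outer s)"
  using hausdorff_measure_space[of s] sigma_algebra.sets_measure_of_eq
  unfolding hausdorff_measure_def measure_space_def by blast

lemma emeasure_hausdorff_measure:
  "A \<in> sets (hausdorff_measure s) \<Longrightarrow> emeasure (hausdorff_measure s) A = hausdorff_outer s A"
  using hausdorff_measure_space[of s] unfolding measure_space_def sets_hausdorff_measure
  by (auto simp: hausdorff_measure_def intro: emeasure_measure_of_sigma)

abbreviation surface_measure :: "(real^'n) measure" where
  "surface_measure \<equiv> hausdorff_measure (CARD('n) - 1)"

abbreviation surface_on :: "(real^'n) set \<Rightarrow> (real^'n) measure" where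
  "surface_on \<Gamma> \<equiv> restrict_space surface_measure \<Gamma>"


section \<open>Domains\<close>

text \<open>Locally, \<open>\<Omega>\<close> lies above the graph of a Lipschitz function over the hyperplane normal to \<open>e\<close>.\<close>

definition lipschitz_boundary :: "'a::euclidean_space set \<Rightarrow> bool" where
  "lipschitz_boundary \<Omega> \<longleftrightarrow>
     (\<forall>x\<in>frontier \<Omega>. \<exists>r>0. \<exists>e. norm e = 1 \<and>
        (\<exists>(\<psi> :: 'a \<Rightarrow> real) L. L-lipschitz_on {y. y \<bullet> e = 0} \<psi> \<and>
           \<Omega> \<inter> ball x r = {y \<in> ball x r. \<psi> (y - (y \<bullet> e) *\<^sub>R e) < y \<bullet> e}))"

definition polyhedral_lipschitz_domain :: "'a::euclidean_space set \<Rightarrow> bool" where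
  "polyhedral_lipschitz_domain \<Omega> \<longleftrightarrow>
     open \<Omega> \<and> connected \<Omega> \<and> \<Omega> \<noteq> {} \<and> bounded \<Omega> \<and> lipschitz_boundary \<Omega> \<and>
     (\<exists>\<P>. finite \<P> \<and> (\<forall>P\<in>\<P>. polytope P) \<and> closure \<Omega> = \<Union>\<P>)"


section \<open>Lebesgue and Sobolev spaces\<close>

definition L2 :: "'a measure \<Rightarrow> ('a \<Rightarrow> 'b::euclidean_space) \<Rightarrow> bool" where
  "L2 M f \<longleftrightarrow> f \<in> borel_measurable M \<and> integrable M (\<lambda>x. (norm (f x))\<^sup>2)"

definition l2_norm :: "'a measure \<Rightarrow> ('a \<Rightarrow> 'b::euclidean_space) \<Rightarrow> real" where
  "l2_norm M f = sqrt (LINT x|M. (norm (f x))\<^sup>2)"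

definition l2_inner :: "'a measure \<Rightarrow> ('a \<Rightarrow> 'b::euclidean_space) \<Rightarrow> ('a \<Rightarrow> 'b) \<Rightarrow> real" where
  "l2_inner M f g = (LINT x|M. f x \<bullet> g x)"

definition partial_deriv :: "'n \<Rightarrow> (real^'n \<Rightarrow> real) \<Rightarrow> real^'n \<Rightarrow> real" where
  "partial_deriv k \<phi> x = frechet_derivative \<phi> (at x) (axis k 1)"

primrec cont_diff :: "nat \<Rightarrow> (real^'n \<Rightarrow> real) \<Rightarrow> bool" where
  "cont_diff 0 \<phi> = continuous_on UNIV \<phi>"
| "cont_diff (Suc m) \<phi> =
     ((\<forall>x. \<phi> differentiable at x) \<and> (\<forall>k. cont_diff m (partial_deriv k \<phi>)))"

definition test_function :: "(real^'n) set \<Rightarrow> (real^'n \<Rightarrow> real) \<Rightarrow> bool" where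
  "test_function \<Omega> \<phi> \<longleftrightarrow>
     (\<forall>m. cont_diff m \<phi>) \<and> (\<exists>K\<subseteq>\<Omega>. compact K \<and> (\<forall>x. x \<notin> K \<longrightarrow> \<phi> x = 0))"

text \<open>\<open>G x $ k $ l\<close> represents the weak derivative of the component \<open>v x $ l\<close> in direction \<open>k\<close>.\<close>

definition has_weak_grad :: "(real^'n) set \<Rightarrow> (real^'n \<Rightarrow> real^'n) \<Rightarrow> (real^'n \<Rightarrow> real^'n^'n) \<Rightarrow> bool" where
  "has_weak_grad \<Omega> v G \<longleftrightarrow>
     (\<forall>\<phi> k l. test_function \<Omega> \<phi> \<longrightarrow>
        (LINT x|lebesgue_on \<Omega>. v x $ l * partial_deriv k \<phi> x) =
        - (LINT x|lebesgue_on \<Omega>. G x $ k $ l * \<phi> x))"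

definition H1 :: "(real^'n) set \<Rightarrow> (real^'n \<Rightarrow> real^'n) set" where
  "H1 \<Omega> = {v. L2 (lebesgue_on \<Omega>) v \<and> (\<exists>G. L2 (lebesgue_on \<Omega>) G \<and> has_weak_grad \<Omega> v G)}"

text \<open>The weak gradient is unique up to null sets; we select one representative.\<close>

definition weak_grad :: "(real^'n) set \<Rightarrow> (real^'n \<Rightarrow> real^'n) \<Rightarrow> real^'n \<Rightarrow> real^'n^'n" where
  "weak_grad \<Omega> v = (SOME G. L2 (lebesgue_on \<Omega>) G \<and> has_weak_grad \<Omega> v G)"

definition h1_norm :: "(real^'n) set \<Rightarrow> (real^'n \<Rightarrow> real^'n) \<Rightarrow> real" where
  "h1_norm \<Omega> v =
     sqrt ((l2_norm (lebesgue_on \<Omega>) v)\<^sup>2 + (l2_norm (lebesgue_on \<Omega>) (weak_grad \<Omega> v))\<^sup>2)"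

text \<open>
  The trace onto \<open>\<Gamma>\<close> is the bounded linear extension to \<open>H1 \<Omega>\<close> of the restriction of functions
  continuous up to the boundary. On a bounded Lipschitz domain it exists and, functions on \<open>\<Gamma>\<close>
  being identified almost everywhere, it is unique.
\<close>

definition trace_operator ::
  "(real^'n) set \<Rightarrow> (real^'n) set \<Rightarrow> ((real^'n \<Rightarrow> real^'n) \<Rightarrow> real^'n \<Rightarrow> real^'n) \<Rightarrow> bool" where
  "trace_operator \<Omega> \<Gamma> \<gamma> \<longleftrightarrow>
     (\<forall>v\<in>H1 \<Omega>. L2 (surface_on \<Gamma>) (\<gamma> v)) \<and>
     (\<forall>v\<in>H1 \<Omega>. \<forall>w\<in>H1 \<Omega>. AE x in surface_on \<Gamma>. \<gamma> (\<lambda>y. v y + w y) x = \<gamma> v x + \<gamma> w x) \<and>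
     (\<forall>v\<in>H1 \<Omega>. \<forall>c. AE x in surface_on \<Gamma>. \<gamma> (\<lambda>y. c *\<^sub>R v y) x = c *\<^sub>R \<gamma> v x) \<and>
     (\<exists>K. \<forall>v\<in>H1 \<Omega>. l2_norm (surface_on \<Gamma>) (\<gamma> v) \<le> K * h1_norm \<Omega> v) \<and>
     (\<forall>v\<in>H1 \<Omega>. continuous_on (closure \<Omega>) v \<longrightarrow> (AE x in surface_on \<Gamma>. \<gamma> v x = v x))"

text \<open>\<open>H\<^sup>1\<^sup>/\<^sup>2(\<Gamma>)\<close> as the range of the trace.\<close>

definition H_half ::
  "(real^'n) set \<Rightarrow> (real^'n) set \<Rightarrow> ((real^'n \<Rightarrow> real^'n) \<Rightarrow> real^'n \<Rightarrow> real^'n) \<Rightarrow> (real^'n \<Rightarrow> real^'n) set" where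
  "H_half \<Omega> \<Gamma> \<gamma> = {g. \<exists>v\<in>H1 \<Omega>. AE x in surface_on \<Gamma>. \<gamma> v x = g x}"

definition H1_zero ::
  "(real^'n) set \<Rightarrow> (real^'n) set \<Rightarrow> ((real^'n \<Rightarrow> real^'n) \<Rightarrow> real^'n \<Rightarrow> real^'n) \<Rightarrow> (real^'n \<Rightarrow> real^'n) set" where
  "H1_zero \<Omega> \<Gamma> \<gamma> = {v \<in> H1 \<Omega>. AE x in surface_on \<Gamma>. \<gamma> v x = 0}"


section \<open>Elasticity\<close>

type_synonym 'n tensor4 = "'n \<Rightarrow> 'n \<Rightarrow> 'n \<Rightarrow> 'n \<Rightarrow> real"

definition tensor_apply :: "('n::finite) tensor4 \<Rightarrow> real^'n^'n \<Rightarrow> real^'n^'n" where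
  "tensor_apply a B = (\<chi> i j. \<Sum>k\<in>UNIV. \<Sum>l\<in>UNIV. a i j k l * B $ k $ l)"

text \<open>The double contraction \<open>A : B\<close> is the inner product of \<^typ>\<open>real^'n^'n\<close>.\<close>

definition elasticity_tensor :: "(real^'n) set \<Rightarrow> (real^'n \<Rightarrow> 'n tensor4) \<Rightarrow> real \<Rightarrow> real \<Rightarrow> bool" where
  "elasticity_tensor \<Omega> A \<alpha> \<beta> \<longleftrightarrow>
     (\<forall>i j k l. (\<lambda>x. A x i j k l) \<in> borel_measurable (lebesgue_on \<Omega>) \<and>
        (\<exists>M. AE x in lebesgue_on \<Omega>. \<bar>A x i j k l\<bar> \<le> M)) \<and>
     (AE x in lebesgue_on \<Omega>. \<forall>i j k l.
        A x i j k l = A x j i k l \<and> A x i j k l = A x i j l k \<and> A x i j k l = A x k l i j) \<and>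
     0 < \<alpha> \<and> 0 < \<beta> \<and>
     (AE x in lebesgue_on \<Omega>. \<forall>B. transpose B = B \<longrightarrow>
        \<alpha> * (B \<bullet> B) \<le> tensor_apply (A x) B \<bullet> B \<and> tensor_apply (A x) B \<bullet> B \<le> \<beta> * (B \<bullet> B))"

definition strain :: "(real^'n) set \<Rightarrow> (real^'n \<Rightarrow> real^'n) \<Rightarrow> real^'n \<Rightarrow> real^'n^'n" where
  "strain \<Omega> v x = (1/2) *\<^sub>R (weak_grad \<Omega> v x + transpose (weak_grad \<Omega> v x))"

definition elastic_form ::
  "(real^'n) set \<Rightarrow> (real^'n \<Rightarrow> 'n tensor4) \<Rightarrow> (real^'n \<Rightarrow> real^'n) \<Rightarrow> (real^'n \<Rightarrow> real^'n) \<Rightarrow> real" where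
  "elastic_form \<Omega> A v w =
     (LINT x|lebesgue_on \<Omega>. tensor_apply (A x) (strain \<Omega> v x) \<bullet> strain \<Omega> w x)"

definition korn_constant :: "(real^'n) set \<Rightarrow> (real^'n \<Rightarrow> real^'n) set \<Rightarrow> real \<Rightarrow> bool" where
  "korn_constant \<Omega> V Cko \<longleftrightarrow>
     (\<forall>v\<in>V. l2_norm (lebesgue_on \<Omega>) (weak_grad \<Omega> v) \<le> Cko * l2_norm (lebesgue_on \<Omega>) (strain \<Omega> v))"


section \<open>Meshes and finite element spaces\<close>

definition mesh :: "(real^'n) set \<Rightarrow> (real^'n) set set \<Rightarrow> bool" where
  "mesh \<Omega> \<T> \<longleftrightarrow>
     triangulation \<T> \<and> (\<forall>T\<in>\<T>. int CARD('n) simplex T) \<and> \<Union>\<T> = closure \<Omega>"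

definition mesh_size :: "'a::euclidean_space set set \<Rightarrow> real" where
  "mesh_size \<T> = Max (diameter ` \<T>)"

definition mesh_nodes :: "'a::euclidean_space set set \<Rightarrow> 'a set" where
  "mesh_nodes \<T> = {z. \<exists>T\<in>\<T>. z extreme_point_of T}"

definition shape_regular_family :: "'a::euclidean_space set set set \<Rightarrow> bool" where
  "shape_regular_family \<F> \<longleftrightarrow> (\<exists>\<kappa>>0. \<forall>\<T>\<in>\<F>. \<forall>T\<in>\<T>. \<exists>x. cball x (\<kappa> * diameter T) \<subseteq> T)"

definition quasi_uniform_family :: "'a::euclidean_space set set set \<Rightarrow> bool" where
  "quasi_uniform_family \<F> \<longleftrightarrow> (\<exists>\<kappa>>0. \<forall>\<T>\<in>\<F>. \<forall>T\<in>\<T>. \<kappa> * mesh_size \<T> \<le> diameter T)"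

definition refines_mesh :: "'a set set \<Rightarrow> 'a set set \<Rightarrow> bool" where
  "refines_mesh \<T> \<T>' \<longleftrightarrow> (\<forall>T\<in>\<T>. \<exists>T'\<in>\<T>'. T \<subseteq> T')"

definition element_patch :: "'a set set \<Rightarrow> 'a set \<Rightarrow> 'a set" where
  "element_patch \<T> T = \<Union>{T'\<in>\<T>. T' \<inter> T \<noteq> {}}"

text \<open>
  A function on \<open>closure \<Omega>\<close> is represented by its extension by zero, so that equality of finite
  element functions is equality of HOL functions.
\<close>

definition affine_fe :: "(real^'n) set \<Rightarrow> (real^'n) set set \<Rightarrow> (real^'n \<Rightarrow> real^'n) set" where
  "affine_fe \<Omega> \<T> =
     {v. continuous_on (closure \<Omega>) v \<and>
         (\<forall>T\<in>\<T>. \<exists>(M :: real^'n^'n) c. \<forall>x\<in>T. v x = M *v x + c) \<and>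
         (\<forall>x. x \<notin> closure \<Omega> \<longrightarrow> v x = 0)}"

definition linear_between ::
  "('a \<Rightarrow> 'b::real_vector) set \<Rightarrow> ('a \<Rightarrow> 'b) set \<Rightarrow> (('a \<Rightarrow> 'b) \<Rightarrow> 'a \<Rightarrow> 'b) \<Rightarrow> bool" where
  "linear_between V W J \<longleftrightarrow>
     (\<forall>v\<in>V. J v \<in> W) \<and>
     (\<forall>v\<in>V. \<forall>w\<in>V. J (\<lambda>x. v x + w x) = (\<lambda>x. J v x + J w x)) \<and>
     (\<forall>v\<in>V. \<forall>c. J (\<lambda>x. c *\<^sub>R v x) = (\<lambda>x. c *\<^sub>R J v x))"

text \<open>Here \<open>\<T>\<close> is the coarse mesh, and \<open>J\<close> is constrained only on the fine space \<open>Vh\<close>.\<close>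

definition interpolation_operator ::
  "(real^'n) set \<Rightarrow> (real^'n) set set \<Rightarrow> (real^'n \<Rightarrow> real^'n) set \<Rightarrow> (real^'n \<Rightarrow> real^'n) set \<Rightarrow>
   ((real^'n \<Rightarrow> real^'n) \<Rightarrow> real^'n \<Rightarrow> real^'n) \<Rightarrow> real \<Rightarrow> bool" where
  "interpolation_operator \<Omega> \<T> Vh VH J CI \<longleftrightarrow>
     linear_between Vh VH J \<and> (\<forall>v\<in>Vh. J (J v) = J v) \<and>
     (\<forall>T\<in>\<T>. \<forall>v\<in>Vh.
        inverse (diameter T) * l2_norm (lebesgue_on T) (\<lambda>x. v x - J v x)
          + l2_norm (lebesgue_on T) (weak_grad \<Omega> (J v))
        \<le> CI * l2_norm (lebesgue_on (element_patch \<T> T)) (weak_grad \<Omega> v))"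

definition global_interpolation_constant ::
  "(real^'n) set \<Rightarrow> real \<Rightarrow> (real^'n \<Rightarrow> real^'n) set \<Rightarrow>
   ((real^'n \<Rightarrow> real^'n) \<Rightarrow> real^'n \<Rightarrow> real^'n) \<Rightarrow> real \<Rightarrow> bool" where
  "global_interpolation_constant \<Omega> H Vh J C\<rho> \<longleftrightarrow>
     (\<forall>v\<in>Vh.
        inverse H * l2_norm (lebesgue_on \<Omega>) (\<lambda>x. v x - J v x)
          + l2_norm (lebesgue_on \<Omega>) (weak_grad \<Omega> (J v))
        \<le> C\<rho> * l2_norm (lebesgue_on \<Omega>) (weak_grad \<Omega> v))"


section \<open>Reference solution and ideal multiscale method\<close>

text \<open>
  Discrete test functions \<open>v\<close> are continuous on \<open>closure \<Omega>\<close>, so their trace on the Neumann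
  boundary is given by their values there.
\<close>

definition load ::
  "(real^'n) set \<Rightarrow> (real^'n) set \<Rightarrow> (real^'n \<Rightarrow> real^'n) \<Rightarrow> (real^'n \<Rightarrow> real^'n) \<Rightarrow>
   (real^'n \<Rightarrow> real^'n) \<Rightarrow> real" where
  "load \<Omega> \<Gamma>N f b v = l2_inner (lebesgue_on \<Omega>) f v + l2_inner (surface_on \<Gamma>N) b v"

definition reference_solution ::
  "(real^'n) set \<Rightarrow> (real^'n) set \<Rightarrow> (real^'n \<Rightarrow> 'n tensor4) \<Rightarrow> (real^'n \<Rightarrow> real^'n) \<Rightarrow>
   (real^'n \<Rightarrow> real^'n) \<Rightarrow> (real^'n \<Rightarrow> real^'n) set \<Rightarrow> (real^'n \<Rightarrow> real^'n) \<Rightarrow>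
   (real^'n \<Rightarrow> real^'n) \<Rightarrow> bool" where
  "reference_solution \<Omega> \<Gamma>N A f b Vh gh u \<longleftrightarrow>
     (\<exists>u0\<in>Vh. u = (\<lambda>x. u0 x + gh x) \<and>
        (\<forall>v\<in>Vh. elastic_form \<Omega> A u0 v = load \<Omega> \<Gamma>N f b v - elastic_form \<Omega> A gh v))"

definition fine_space ::
  "(real^'n \<Rightarrow> real^'n) set \<Rightarrow> ((real^'n \<Rightarrow> real^'n) \<Rightarrow> real^'n \<Rightarrow> real^'n) \<Rightarrow>
   (real^'n \<Rightarrow> real^'n) set" where
  "fine_space Vh J = {v \<in> Vh. J v = (\<lambda>x. 0)}"

definition fine_corrector ::
  "(real^'n) set \<Rightarrow> (real^'n \<Rightarrow> 'n tensor4) \<Rightarrow> (real^'n \<Rightarrow> real^'n) set \<Rightarrow>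
   (real^'n \<Rightarrow> real^'n) set \<Rightarrow> ((real^'n \<Rightarrow> real^'n) \<Rightarrow> real^'n \<Rightarrow> real^'n) \<Rightarrow> bool" where
  "fine_corrector \<Omega> A Sh Vf R \<longleftrightarrow>
     (\<forall>v\<in>Sh. R v \<in> Vf \<and> (\<forall>w\<in>Vf. elastic_form \<Omega> A (R v) w = elastic_form \<Omega> A v w))"

definition neumann_corrector ::
  "(real^'n) set \<Rightarrow> (real^'n) set \<Rightarrow> (real^'n \<Rightarrow> 'n tensor4) \<Rightarrow> (real^'n \<Rightarrow> real^'n) \<Rightarrow>
   (real^'n \<Rightarrow> real^'n) set \<Rightarrow> (real^'n \<Rightarrow> real^'n) \<Rightarrow> bool" where
  "neumann_corrector \<Omega> \<Gamma>N A b Vf bf \<longleftrightarrow>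
     bf \<in> Vf \<and> (\<forall>w\<in>Vf. elastic_form \<Omega> A bf w = l2_inner (surface_on \<Gamma>N) b w)"

definition multiscale_space ::
  "(real^'n \<Rightarrow> real^'n) set \<Rightarrow> ((real^'n \<Rightarrow> real^'n) \<Rightarrow> real^'n \<Rightarrow> real^'n) \<Rightarrow>
   (real^'n \<Rightarrow> real^'n) set" where
  "multiscale_space VH R = {(\<lambda>x. v x - R v x) | v. v \<in> VH}"

definition ideal_solution ::
  "(real^'n) set \<Rightarrow> (real^'n) set \<Rightarrow> (real^'n \<Rightarrow> 'n tensor4) \<Rightarrow> (real^'n \<Rightarrow> real^'n) \<Rightarrow>
   (real^'n \<Rightarrow> real^'n) \<Rightarrow> (real^'n \<Rightarrow> real^'n) set \<Rightarrow> ((real^'n \<Rightarrow> real^'n) \<Rightarrow> real^'n \<Rightarrow> real^'n) \<Rightarrow>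
   (real^'n \<Rightarrow> real^'n) \<Rightarrow> (real^'n \<Rightarrow> real^'n) \<Rightarrow> (real^'n \<Rightarrow> real^'n) \<Rightarrow> bool" where
  "ideal_solution \<Omega> \<Gamma>N A f b VH R bf gh u \<longleftrightarrow>
     (\<exists>u0\<in>multiscale_space VH R. u = (\<lambda>x. u0 x + bf x + gh x - R gh x) \<and>
        (\<forall>v\<in>multiscale_space VH R.
           elastic_form \<Omega> A u0 v =
           load \<Omega> \<Gamma>N f b v - elastic_form \<Omega> A (\<lambda>x. bf x + gh x - R gh x) v))"

end

theory Submission
  imports Defs "HOL-Real_Asymp.Real_Asymp"
begin

text \<open>
  The error \<open>e\<close> between the reference solution and the ideal multiscale solution belongs to the fine
  space \<open>Vf\<close>, the kernel of the interpolation operator \<open>J\<close>, and there it solves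
  \<open>\<B>(e, w) = (f, w)\<close> for all \<open>w\<close> in \<open>Vf\<close>: the Neumann corrector and the corrected boundary data have
  absorbed all the other data (\<open>ideal_error_decomposition\<close>). Testing with \<open>w = e\<close> gives
  \<open>\<alpha> \<parallel>\<epsilon> e\<parallel>\<^sup>2 \<le> \<parallel>f\<parallel> \<parallel>e\<parallel>\<close> with the strain \<open>\<epsilon> e\<close>. As \<open>J e = 0\<close>, the interpolation estimate reads
  \<open>\<parallel>e\<parallel> \<le> C\<rho> H \<parallel>\<nabla>e\<parallel>\<close>, which gains the factor \<open>H\<close>, and Korn's inequality turns strains into
  gradients (\<open>fine_scale_h1_bound\<close>).

  That \<open>e\<close> lies in the fine space rests on the \<open>\<B>\<close>-orthogonal splitting of the discrete space into the
  fine and the multiscale space. It first shows that the multiscale part of \<open>e\<close> has energy zero. By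
  coercivity and Korn's inequality the weak gradient of that part vanishes, so it is constant on the
  connected domain (\<open>affine_fe_constant\<close>), and it is zero because its trace on the Dirichlet boundary
  is zero (\<open>affine_fe_H1_zero_eq_0\<close>).

  Two analytic facts support this algebra. The elastic form is bilinear only because weak gradients
  are unique up to null sets, which is the fundamental lemma of the calculus of variations
  (\<open>AE_eq_0_if_orthogonal_to_test_functions\<close>); it is proved from explicit smooth cutoffs of boxes.
  The lift \<open>gh\<close> of the boundary data is given merely as a continuous piecewise affine function, and so
  are the functions whose gradient is known to vanish. That such functions have the piecewise gradient
  as weak gradient (\<open>has_weak_grad_affine_fe\<close>) follows from translation invariance of the Lebesgue
  integral applied to difference quotients.
\<close>

section \<open>Smooth cutoff functions\<close>

text \<open>
  Differentiating \<open>exp (- 1 / t)\<close> repeatedly produces powers of \<open>1 / t\<close> as factors. Indexing by that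
  power makes the family closed under differentiation up to linear combinations, so smoothness needs
  no induction over explicit higher derivatives.
\<close>

definition flat_exp :: "nat \<Rightarrow> real \<Rightarrow> real" where
  "flat_exp m t = (if t > 0 then exp (- (1 / t)) / t ^ m else 0)"

lemma flat_exp_deriv:
  "(flat_exp m has_real_derivative flat_exp (m + 2) t - m * flat_exp (m + 1) t) (at t)"
proof -
  consider "t > 0" | "t < 0" | "t = 0" by linarith
  then show ?thesis
  proof cases
    case 1
    have "((\<lambda>t. exp (- (1 / t)) / t ^ m) has_real_derivative
        flat_exp (m + 2) t - m * flat_exp (m + 1) t) (at t)"
    proof -
      have "m * t ^ m = m * (t * t ^ (m - 1))" by (cases m) auto
      then show ?thesis using 1
        by (auto intro!: derivative_eq_intros simp: flat_exp_def divide_simps power2_eq_square)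
          (simp add: algebra_simps)
    qed
    then show ?thesis
      by (rule DERIV_cong_ev[THEN iffD1, rotated 3])
        (use 1 in \<open>auto simp: flat_exp_def intro!: eventually_mono[OF eventually_gt_at_top]
            eventually_mono[OF order_tendstoD(1)[OF tendsto_ident_at 1]]
            eventually_nhds_in_open[of "{0<..}", THEN eventually_mono]\<close>)
  next
    case 2
    have "((\<lambda>t. 0) has_real_derivative 0) (at t)" by simp
    then have "(flat_exp m has_real_derivative 0) (at t)"
      by (rule DERIV_cong_ev[THEN iffD1, rotated 3])
        (use 2 in \<open>auto simp: flat_exp_def
            intro!: eventually_nhds_in_open[of "{..<0}", THEN eventually_mono]\<close>)
    then show ?thesis using 2 by (simp add: flat_exp_def)
  next
    case 3
    have "((\<lambda>h. flat_exp m h / h) \<longlongrightarrow> 0) (at_right 0)"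
    proof -
      have "((\<lambda>h::real. exp (- (1 / h)) / h ^ m / h) \<longlongrightarrow> 0) (at_right 0)"
        by real_asymp
      then show ?thesis
        by (rule Lim_transform_eventually) (auto simp: eventually_at_filter flat_exp_def)
    qed
    moreover have "((\<lambda>h. flat_exp m h / h) \<longlongrightarrow> 0) (at_left 0)"
      by (rule Lim_transform_eventually[OF tendsto_const]) (auto simp: eventually_at_filter flat_exp_def)
    ultimately have "((\<lambda>h. flat_exp m h / h) \<longlongrightarrow> 0) (at 0)"
      by (rule filterlim_split_at[rotated])
    then show ?thesis using 3 by (simp add: DERIV_def flat_exp_def)
  qed
qed

text \<open>
  Test functions are cut out of this algebra: it is closed under every partial derivative and consists
  of differentiable functions, and these two facts alone give derivatives of all orders.
\<close>

inductive_set cutoff_algebra :: "(real^'n \<Rightarrow> real) set" where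
  const: "(\<lambda>x. c) \<in> cutoff_algebra"
| flat: "(\<lambda>x. flat_exp m (c * x $ (k::'n) + d)) \<in> cutoff_algebra"
| add: "\<phi> \<in> cutoff_algebra \<Longrightarrow> \<psi> \<in> cutoff_algebra \<Longrightarrow> (\<lambda>x. \<phi> x + \<psi> x) \<in> cutoff_algebra"
| mult: "\<phi> \<in> cutoff_algebra \<Longrightarrow> \<psi> \<in> cutoff_algebra \<Longrightarrow> (\<lambda>x. \<phi> x * \<psi> x) \<in> cutoff_algebra"

lemma partial_deriv_eqI: "(\<phi> has_derivative D) (at x) \<Longrightarrow> partial_deriv k \<phi> x = D (axis k 1)"
  unfolding partial_deriv_def using frechet_derivative_at[of \<phi> D x] by metis

lemma cutoff_algebra_deriv:
  fixes \<phi> :: "real^'n \<Rightarrow> real"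
  assumes "\<phi> \<in> cutoff_algebra"
  shows "(\<forall>x. \<phi> differentiable at x) \<and> partial_deriv k \<phi> \<in> cutoff_algebra"
  using assms
proof induction
  case (const c)
  have "partial_deriv k (\<lambda>x. c) = (\<lambda>x. 0)"
    by (auto intro!: ext partial_deriv_eqI[where D = "\<lambda>x. 0"])
  then show ?case using cutoff_algebra.const[of 0] by simp
next
  case (flat m c l d)
  have D: "((\<lambda>x. flat_exp m (c * x $ l + d)) has_derivative
      (\<lambda>y. c * y $ l * (flat_exp (m + 2) (c * x $ l + d) - m * flat_exp (m + 1) (c * x $ l + d)))) (at x)"
    for x :: "real^'n"
    by (rule has_derivative_eq_rhs, rule DERIV_compose_FDERIV[OF flat_exp_deriv])
       (auto intro!: derivative_eq_intros bounded_linear.has_derivative[OF bounded_linear_vec_nth])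
  have "partial_deriv k (\<lambda>x. flat_exp m (c * x $ l + d)) =
     (\<lambda>x. (c * axis k 1 $ l) * flat_exp (m + 2) (c * x $ l + d) +
        (- (c * axis k 1 $ l) * m) * flat_exp (m + 1) (c * x $ l + d))"
    by (rule ext) (subst partial_deriv_eqI[OF D], simp add: algebra_simps)
  moreover have "\<dots> \<in> cutoff_algebra"
    by (intro cutoff_algebra.intros)
  ultimately show ?case using D unfolding differentiable_def by auto
next
  case (add \<phi> \<psi>)
  have "partial_deriv k (\<lambda>x. \<phi> x + \<psi> x) = (\<lambda>x. partial_deriv k \<phi> x + partial_deriv k \<psi> x)"
    by (rule ext, subst partial_deriv_eqI[OF has_derivative_add])
       (use add in \<open>auto simp: partial_deriv_def frechet_derivative_works[symmetric]\<close>)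
  then show ?case using add by (auto intro: cutoff_algebra.intros)
next
  case (mult \<phi> \<psi>)
  have "partial_deriv k (\<lambda>x. \<phi> x * \<psi> x) = (\<lambda>x. \<phi> x * partial_deriv k \<psi> x + partial_deriv k \<phi> x * \<psi> x)"
    by (rule ext, subst partial_deriv_eqI[OF has_derivative_mult])
       (use mult in \<open>auto simp: partial_deriv_def frechet_derivative_works[symmetric]\<close>)
  then show ?case using mult by (auto intro: cutoff_algebra.intros)
qed

lemma cutoff_algebra_cont_diff: "\<phi> \<in> cutoff_algebra \<Longrightarrow> cont_diff m \<phi>"
proof (induction m arbitrary: \<phi>)
  case 0
  then have "\<phi> differentiable at x" for x using cutoff_algebra_deriv by blast
  then show ?case
    by (auto intro!: continuous_at_imp_continuous_on differentiable_imp_continuous_within)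
next
  case (Suc m)
  then show ?case using cutoff_algebra_deriv by auto
qed

lemma cutoff_algebra_prod:
  "finite I \<Longrightarrow> (\<And>i. i \<in> I \<Longrightarrow> \<phi> i \<in> cutoff_algebra) \<Longrightarrow> (\<lambda>x. \<Prod>i\<in>I. \<phi> i x) \<in> cutoff_algebra"
  by (induction I rule: finite_induct) (auto intro: cutoff_algebra.intros)

text \<open>
  The shift by \<open>1\<close> keeps the support inside a closed box that is strictly smaller than \<open>box a b\<close>, so
  that the support is compact in any open set containing \<open>box a b\<close>; as \<open>n\<close> grows each factor tends to
  \<open>1\<close> inside the open box.
\<close>

definition box_cutoff :: "real^'n \<Rightarrow> real^'n \<Rightarrow> nat \<Rightarrow> real^'n \<Rightarrow> real" where
  "box_cutoff a b n x =
     (\<Prod>k\<in>UNIV. flat_exp 0 (n * (x $ k - a $ k) - 1) * flat_exp 0 (n * (b $ k - x $ k) - 1))"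

lemma box_cutoff_in_algebra:
  fixes a b :: "real^'n"
  shows "box_cutoff a b n \<in> cutoff_algebra"
proof -
  have "(\<lambda>x. \<Prod>k\<in>UNIV. flat_exp 0 (real n * x $ k + (- (real n * a $ k) - 1)) *
      flat_exp 0 (- real n * x $ k + (real n * b $ k - 1))) \<in> (cutoff_algebra :: (real^'n \<Rightarrow> real) set)"
    by (intro cutoff_algebra_prod cutoff_algebra.intros) auto
  also have "(\<lambda>x. \<Prod>k\<in>UNIV. flat_exp 0 (real n * x $ k + (- (real n * a $ k) - 1)) *
      flat_exp 0 (- real n * x $ k + (real n * b $ k - 1))) = box_cutoff a b n"
    by (auto simp: box_cutoff_def fun_eq_iff algebra_simps)
  finally show ?thesis .
qed

lemma flat_exp_0_bounds: "0 \<le> flat_exp 0 t" "flat_exp 0 t \<le> 1"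
  by (auto simp: flat_exp_def)

lemma box_cutoff_bounds: "0 \<le> box_cutoff a b n x" "box_cutoff a b n x \<le> 1"
  unfolding box_cutoff_def
  by (auto intro!: prod_nonneg prod_le_1 mult_nonneg_nonneg mult_le_one simp: flat_exp_0_bounds)

lemma box_cutoff_support:
  assumes "box_cutoff a b n x \<noteq> 0" "n > 0"
  shows "x \<in> cbox (\<chi> k. a $ k + 1 / n) (\<chi> k. b $ k - 1 / n)"
proof -
  have "flat_exp 0 (n * (x $ k - a $ k) - 1) \<noteq> 0" "flat_exp 0 (n * (b $ k - x $ k) - 1) \<noteq> 0" for k
    using assms by (auto simp: box_cutoff_def)
  then have "n * (x $ k - a $ k) - 1 > 0" "n * (b $ k - x $ k) - 1 > 0" for k
    unfolding flat_exp_def by metis+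
  then have "a $ k + 1 / n \<le> x $ k \<and> x $ k \<le> b $ k - 1 / n" for k
    using assms(2) by (simp add: field_simps) (meson less_imp_le)
  then show ?thesis by (auto simp: mem_box_cart)
qed

lemma shrunk_cbox_subset: "n > 0 \<Longrightarrow> cbox (\<chi> k. a $ k + 1 / real n) (\<chi> k. b $ k - 1 / n) \<subseteq> box a b"
  by (auto simp: mem_box_cart) (smt (verit) divide_pos_pos of_nat_0_less_iff)+

lemma box_cutoff_tendsto:
  assumes "x \<in> box a b"
  shows "(\<lambda>n. box_cutoff a b n x) \<longlonglongrightarrow> 1"
proof -
  have *: "(\<lambda>n. flat_exp 0 (real n * t - 1)) \<longlonglongrightarrow> 1" if "t > 0" for t
  proof -
    have "(\<lambda>n. exp (- (1 / (real n * t - 1)))) \<longlonglongrightarrow> 1"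
      using that by real_asymp
    moreover have "\<forall>\<^sub>F n in sequentially. real n * t - 1 > 0"
      using that by real_asymp
    ultimately show ?thesis
      by (elim Lim_transform_eventually) (auto simp: flat_exp_def elim: eventually_mono)
  qed
  have "(\<lambda>n. box_cutoff a b n x) \<longlonglongrightarrow> (\<Prod>k\<in>(UNIV::'a set). 1 * 1)"
    unfolding box_cutoff_def
    by (intro tendsto_prod tendsto_mult *) (use assms in \<open>auto simp: mem_box_cart\<close>)
  then show ?thesis by simp
qed

text \<open>
  An open set is a countable union of open boxes \<open>B i\<close>. With cutoffs \<open>\<psi> i\<close> of the boxes,
  \<open>1 - (\<Prod>i<n. 1 - \<psi> i)\<close> behaves like the indicator of \<open>\<Union>i<n. B i\<close>: it stays in \<open>[0, 1]\<close>, vanishes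
  off the union, and tends to \<open>1\<close> wherever one of the cutoffs does.
\<close>

lemma test_functions_to_indicator:
  fixes U \<Omega> :: "(real^'n) set"
  assumes "open U" "U \<subseteq> \<Omega>"
  obtains \<phi> where "\<And>n. test_function \<Omega> (\<phi> n)" "\<And>n x. \<bar>\<phi> n x\<bar> \<le> 1"
    "\<And>x. (\<lambda>n. \<phi> n x) \<longlonglongrightarrow> indicator U x"
proof -
  obtain \<D> where \<D>: "countable \<D>" "\<D> \<subseteq> Pow U" "\<And>X. X \<in> \<D> \<Longrightarrow> \<exists>a b. X = box a b" "\<Union>\<D> = U"
    using open_countable_Union_open_box[OF assms(1)] by metis
  \<comment> \<open>The empty box is added because the enumeration needs a nonempty family.\<close>
  define B where "B = from_nat_into (insert {} \<D>)"
  have B: "range B = insert {} \<D>"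
    unfolding B_def by (rule range_from_nat_into) (use \<D>(1) in auto)
  have "\<exists>a b. B i = box a b" for i :: nat
  proof (cases "B i \<in> \<D>")
    case False
    then have "B i = {}" using B by blast
    also have "{} = box (0::real^'n) 0" by simp
    finally show ?thesis by blast
  qed (use \<D>(3) in blast)
  then obtain a b where ab: "\<And>i. B i = box (a i) (b i)" by metis
  have U: "U = (\<Union>i. box (a i) (b i))"
  proof -
    have "U = \<Union> (range B)" by (simp add: B \<D>(4))
    then show ?thesis using ab by auto
  qed
  define \<phi> where "\<phi> n x = 1 + (- 1) * (\<Prod>i<n. 1 + (- 1) * box_cutoff (a i) (b i) (Suc n) x)" for n x
  have prod: "0 \<le> (\<Prod>i<n. 1 + (- 1) * box_cutoff (a i) (b i) m x)"
     "(\<Prod>i<n. 1 + (- 1) * box_cutoff (a i) (b i) m x) \<le> 1" for n m x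
    using box_cutoff_bounds[of "a _" "b _" m x] by (auto intro!: prod_nonneg prod_le_1)
  have alg: "\<phi> n \<in> cutoff_algebra" for n
    unfolding \<phi>_def by (intro cutoff_algebra.intros cutoff_algebra_prod box_cutoff_in_algebra) auto
  show ?thesis
  proof
    fix n
    let ?C = "\<lambda>i. cbox (\<chi> k. a i $ k + 1 / real (Suc n)) (\<chi> k. b i $ k - 1 / real (Suc n))"
    have "?C i \<subseteq> U" for i
      unfolding U using shrunk_cbox_subset[of "Suc n" "a i" "b i"] by auto
    moreover have "\<phi> n x = 0" if "x \<notin> (\<Union>i<n. ?C i)" for x
    proof -
      have "box_cutoff (a i) (b i) (Suc n) x = 0" if "i < n" for i
        using box_cutoff_support[of "a i" "b i" "Suc n" x] \<open>x \<notin> _\<close> that by blast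
      then show ?thesis by (simp add: \<phi>_def)
    qed
    moreover have "compact (\<Union>i<n. ?C i)" by (intro compact_UN) auto
    ultimately show "test_function \<Omega> (\<phi> n)"
      unfolding test_function_def using cutoff_algebra_cont_diff[OF alg] assms(2)
      by (intro conjI allI exI[of _ "\<Union>i<n. ?C i"]) blast+
  next
    fix n x show "\<bar>\<phi> n x\<bar> \<le> 1" using prod[where n=n and m="Suc n" and x=x] by (simp add: \<phi>_def)
  next
    fix x
    show "(\<lambda>n. \<phi> n x) \<longlonglongrightarrow> indicator U x"
    proof (cases "x \<in> U")
      case False
      have "box_cutoff (a i) (b i) (Suc n) x = 0" for i n
        using box_cutoff_support[of "a i" "b i" "Suc n" x] shrunk_cbox_subset[of "Suc n" "a i" "b i"] False
        unfolding U by blast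
      then show ?thesis using False by (simp add: \<phi>_def)
    next
      case True
      then obtain i where i: "x \<in> box (a i) (b i)" unfolding U by auto
      have "(\<lambda>n. \<Prod>i<n. 1 + (- 1) * box_cutoff (a i) (b i) (Suc n) x) \<longlonglongrightarrow> 0"
      proof (rule tendsto_sandwich[of "\<lambda>_. 0" _ _ "\<lambda>n. 1 - box_cutoff (a i) (b i) (Suc n) x"])
        show "(\<lambda>n. 1 - box_cutoff (a i) (b i) (Suc n) x) \<longlonglongrightarrow> 0"
          using tendsto_diff[OF tendsto_const[of 1] LIMSEQ_Suc[OF box_cutoff_tendsto[OF i]]] by simp
        show "\<forall>\<^sub>F n in sequentially. (\<Prod>i<n. 1 + (- 1) * box_cutoff (a i) (b i) (Suc n) x)
            \<le> 1 - box_cutoff (a i) (b i) (Suc n) x"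
          using eventually_gt_at_top[of i]
        proof eventually_elim
          case (elim n)
          have "(\<Prod>j<n. 1 + (- 1) * box_cutoff (a j) (b j) (Suc n) x) =
             (1 - box_cutoff (a i) (b i) (Suc n) x) *
             (\<Prod>j\<in>{..<n}-{i}. 1 + (- 1) * box_cutoff (a j) (b j) (Suc n) x)"
            using elim by (subst prod.remove[of _ i]) auto
          also have "\<dots> \<le> (1 - box_cutoff (a i) (b i) (Suc n) x) * 1"
            using box_cutoff_bounds[of "a _" "b _" "Suc n" x]
            by (intro mult_left_mono prod_le_1) auto
          finally show ?case by simp
        qed
      qed (use prod in auto)
      then show ?thesis using True unfolding \<phi>_def
        using tendsto_add[OF tendsto_const[of 1] tendsto_mult[OF tendsto_const[of "-1::real"]]] by fastforce
    qed
  qed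
qed

section \<open>The fundamental lemma of the calculus of variations\<close>

lemma test_function_differentiable: "test_function \<Omega> \<phi> \<Longrightarrow> \<phi> differentiable at x"
  unfolding test_function_def by (metis cont_diff.simps(2))

lemma test_function_continuous: "test_function \<Omega> \<phi> \<Longrightarrow> continuous_on UNIV \<phi>"
  unfolding test_function_def by (metis cont_diff.simps(1))

lemma partial_deriv_continuous: "test_function \<Omega> \<phi> \<Longrightarrow> continuous_on UNIV (partial_deriv k \<phi>)"
  unfolding test_function_def by (metis cont_diff.simps One_nat_def)

lemma continuous_borel_lebesgue_on:
  fixes f :: "'a::euclidean_space \<Rightarrow> 'b::topological_space"
  shows "continuous_on UNIV f \<Longrightarrow> f \<in> borel_measurable (lebesgue_on S)"
  using measurable_restrict_space1[OF measurable_completion[of f lborel borel]]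
  by (simp add: borel_measurable_continuous_onI)

lemma lebesgue_on_integral_indicator:
  fixes u :: "'a::euclidean_space \<Rightarrow> real"
  assumes "S \<in> sets lebesgue"
  shows "integral\<^sup>L (lebesgue_on S) u = (LINT x|lebesgue. indicator S x * u x)"
    "integrable (lebesgue_on S) u \<longleftrightarrow> integrable lebesgue (\<lambda>x. indicator S x * u x)"
  using assms by (simp_all add: integral_restrict_space integrable_restrict_space)

text \<open>
  The sets over which \<open>u\<close> integrates to zero form a Dynkin system, and the open sets are a generator
  of the Borel sets that is stable under intersection.
\<close>

lemma integral_eq_0_on_open_imp_AE_0:
  fixes u :: "'a::euclidean_space \<Rightarrow> real"
  assumes u: "integrable lborel u"
    and zero: "\<And>S. open S \<Longrightarrow> (LINT x:S|lborel. u x) = 0"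
  shows "AE x in lborel. u x = 0"
proof -
  have int: "set_integrable lborel A u" if "A \<in> sets borel" for A
    unfolding set_integrable_def using u that by (intro integrable_mult_indicator) auto
  have "(LINT x:A|lborel. u x) = 0" if "A \<in> sets lborel" for A
  proof -
    have A: "A \<in> sigma_sets UNIV {S. open S}"
      using that by (simp add: borel_def)
    have I: "Int_stable {S::'a set. open S}" by (auto simp: Int_stable_def)
    have "{S::'a set. open S} \<subseteq> Pow UNIV" by simp
    from I this A show ?thesis
    proof (induction rule: sigma_sets_induct_disjoint)
      case (compl A)
      have A: "A \<in> sets borel" using compl(1) by (simp add: borel_def)
      have "(LINT x:(A \<union> (UNIV - A))|lborel. u x) = (LINT x:A|lborel. u x) + (LINT x:(UNIV - A)|lborel. u x)"
        using A by (intro set_integral_Un int) auto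
      then show ?case using zero[of UNIV] compl(2) by (simp add: Un_Diff_cancel)
    next
      case (union A)
      have A: "A i \<in> sets borel" for i using union(2) by (auto simp: borel_def)
      have "(LINT x:(\<Union>i. A i)|lborel. u x) = (\<Sum>i. (LINT x:A i|lborel. u x))"
        using A union(1) by (intro lebesgue_integral_countable_add int)
          (auto simp: disjoint_family_on_def)
      then show ?case using union(3) by simp
    qed (use zero in \<open>auto simp: set_lebesgue_integral_def\<close>)
  qed
  then show ?thesis
    using density_unique_real[OF u, of "\<lambda>_. 0"] by (simp add: set_lebesgue_integral_def)
qed

text \<open>
  Dominated convergence along test functions that approximate the indicator of \<open>S \<inter> \<Omega>\<close> turns the
  hypothesis into \<open>u\<close> having integral zero over every open subset of \<open>\<Omega>\<close>.
\<close>

lemma AE_eq_0_if_orthogonal_to_test_functions: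
  fixes u :: "real^'n \<Rightarrow> real"
  assumes "open \<Omega>" and u: "integrable (lebesgue_on \<Omega>) u"
    and zero: "\<And>\<phi>. test_function \<Omega> \<phi> \<Longrightarrow> (LINT x|lebesgue_on \<Omega>. u x * \<phi> x) = 0"
  shows "AE x in lebesgue_on \<Omega>. u x = 0"
proof -
  have \<Omega>: "\<Omega> \<in> sets lebesgue" using \<open>open \<Omega>\<close> by auto
  define U where "U x = indicator \<Omega> x * u x" for x
  have U: "integrable lebesgue U"
    using u \<Omega> by (simp add: lebesgue_on_integral_indicator U_def[abs_def])
  \<comment> \<open>The Dynkin argument lives on Borel sets, so the Lebesgue measurable function is replaced by a Borel representative.\<close>
  then obtain U' where U': "U' \<in> borel_measurable lborel" "AE x in lborel. U x = U' x"
    using completion_ex_borel_measurable_real[of U lborel] by auto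
  have AE_U: "AE x in lebesgue. U x = U' x" using U'(2) by (rule AE_completion)
  have "integrable lebesgue U'"
    using U AE_U measurable_completion[OF U'(1)]
    by (subst integrable_cong_AE[where g = U]) (auto elim: AE_mp)
  then have int: "integrable lborel U'"
    using U'(1) by (simp add: integrable_completion)
  have "(LINT x:S|lborel. U' x) = 0" if S: "open S" for S
  proof -
    obtain \<phi> where \<phi>: "\<And>n. test_function \<Omega> (\<phi> n)" "\<And>n x. \<bar>\<phi> n x\<bar> \<le> 1"
      "\<And>x. (\<lambda>n. \<phi> n x) \<longlonglongrightarrow> indicator (S \<inter> \<Omega>) x"
      using test_functions_to_indicator[OF open_Int[OF S \<open>open \<Omega>\<close>] Int_lower2] by blast
    have SO: "S \<inter> \<Omega> \<in> sets lebesgue" using that \<open>open \<Omega>\<close> by auto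
    have "(\<lambda>n. LINT x|lebesgue_on \<Omega>. u x * \<phi> n x) \<longlonglongrightarrow> (LINT x|lebesgue_on \<Omega>. u x * indicator (S \<inter> \<Omega>) x)"
    proof (rule integral_dominated_convergence[where w = "\<lambda>x. \<bar>u x\<bar>"])
      have "indicat_real (S \<inter> \<Omega>) \<in> borel_measurable (lebesgue_on \<Omega>)"
        using SO by (intro measurable_restrict_space1 borel_measurable_indicator)
      then show "(\<lambda>x. u x * indicator (S \<inter> \<Omega>) x) \<in> borel_measurable (lebesgue_on \<Omega>)"
        using u by (intro borel_measurable_times) auto
      show "(\<lambda>x. u x * \<phi> n x) \<in> borel_measurable (lebesgue_on \<Omega>)" for n
        using borel_measurable_integrable[OF u]
          continuous_borel_lebesgue_on[OF test_function_continuous[OF \<phi>(1)]]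
        by (rule borel_measurable_times)
      show "AE x in lebesgue_on \<Omega>. norm (u x * \<phi> n x) \<le> \<bar>u x\<bar>" for n
        using \<phi>(2)[of n] by (auto simp: abs_mult mult_left_le)
    qed (use u \<phi>(3) in \<open>auto intro!: tendsto_mult\<close>)
    then have "(LINT x|lebesgue_on \<Omega>. u x * indicator (S \<inter> \<Omega>) x) = 0"
      using zero[OF \<phi>(1)] by (simp add: LIMSEQ_const_iff)
    moreover have "(LINT x|lebesgue_on \<Omega>. u x * indicator (S \<inter> \<Omega>) x) =
        (LINT x|lebesgue. indicator S x *\<^sub>R U x)"
      unfolding lebesgue_on_integral_indicator[OF \<Omega>] U_def
      by (intro Bochner_Integration.integral_cong) (auto simp: indicator_def)
    moreover have "\<dots> = (LINT x|lebesgue. indicator S x *\<^sub>R U' x)"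
      using AE_U that U measurable_completion[OF U'(1)] by (intro integral_cong_AE)
        (auto intro!: borel_measurable_times borel_measurable_indicator elim: AE_mp)
    moreover have "\<dots> = (LINT x:S|lborel. U' x)"
      unfolding set_lebesgue_integral_def using that U'(1)
      by (intro integral_completion) auto
    ultimately show ?thesis by simp
  qed
  then have "AE x in lborel. U' x = 0"
    by (rule integral_eq_0_on_open_imp_AE_0[OF int])
  then have "AE x in lebesgue. U' x = 0" by (rule AE_completion)
  with AE_U have "AE x in lebesgue. x \<in> \<Omega> \<longrightarrow> u x = 0"
    by eventually_elim (auto simp: U_def)
  then show ?thesis using \<Omega> by (simp add: AE_restrict_space_iff)
qed

section \<open>Square integrable functions\<close>

lemma L2_measurable: "L2 M f \<Longrightarrow> f \<in> borel_measurable M"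
  by (simp add: L2_def)

lemma L2_bound:
  fixes f :: "'a \<Rightarrow> 'b::euclidean_space"
  assumes "f \<in> borel_measurable M" "integrable M g" "\<And>x. x \<in> space M \<Longrightarrow> (norm (f x))\<^sup>2 \<le> g x"
  shows "L2 M f"
  unfolding L2_def
proof
  show "integrable M (\<lambda>x. (norm (f x))\<^sup>2)"
    by (rule Bochner_Integration.integrable_bound[OF assms(2)])
      (use assms in \<open>auto intro!: AE_I2 order_trans[OF _ abs_ge_self]\<close>)
qed fact

lemma L2_add:
  fixes f g :: "'a \<Rightarrow> 'b::euclidean_space"
  assumes "L2 M f" "L2 M g"
  shows "L2 M (\<lambda>x. f x + g x)"
proof (rule L2_bound[where g = "\<lambda>x. 2 * ((norm (f x))\<^sup>2 + (norm (g x))\<^sup>2)"])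
  fix x
  have "(norm (f x + g x))\<^sup>2 \<le> (norm (f x) + norm (g x))\<^sup>2"
    by (intro power_mono norm_triangle_ineq) auto
  also have "\<dots> \<le> 2 * ((norm (f x))\<^sup>2 + (norm (g x))\<^sup>2)"
    using sum_squares_bound[of "norm (f x)" "norm (g x)"] by (simp add: power2_sum)
  finally show "(norm (f x + g x))\<^sup>2 \<le> 2 * ((norm (f x))\<^sup>2 + (norm (g x))\<^sup>2)" .
qed (use assms in \<open>auto simp: L2_def\<close>)

lemma L2_bounded_linear:
  fixes f :: "'a \<Rightarrow> 'b::euclidean_space" and T :: "'b \<Rightarrow> 'c::euclidean_space"
  assumes "L2 M f" "bounded_linear T"
  shows "L2 M (\<lambda>x. T (f x))"
proof -
  obtain K where K: "\<And>x. norm (T x) \<le> norm x * K"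
    using bounded_linear.bounded[OF assms(2)] by blast
  show ?thesis
  proof (rule L2_bound[where g = "\<lambda>x. K\<^sup>2 * (norm (f x))\<^sup>2"])
    show "(\<lambda>x. T (f x)) \<in> borel_measurable M"
      using borel_measurable_continuous_onI[OF linear_continuous_on[OF assms(2)]] L2_measurable[OF assms(1)]
      by (rule measurable_compose_rev)
    fix x
    have "(norm (T (f x)))\<^sup>2 \<le> (norm (f x) * K)\<^sup>2" by (intro power_mono K) auto
    then show "(norm (T (f x)))\<^sup>2 \<le> K\<^sup>2 * (norm (f x))\<^sup>2" by (simp add: power_mult_distrib mult.commute)
  qed (use assms(1) in \<open>auto simp: L2_def\<close>)
qed

lemma L2_scaleR: "L2 M f \<Longrightarrow> L2 M (\<lambda>x. c *\<^sub>R f x)"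
  by (rule L2_bounded_linear[OF _ bounded_linear_scaleR_right])

lemma L2_vec_nth: "L2 M f \<Longrightarrow> L2 M (\<lambda>x. f x $ i)"
  by (rule L2_bounded_linear[OF _ bounded_linear_vec_nth])

lemma integrable_L2_inner:
  fixes f g :: "'a \<Rightarrow> 'b::euclidean_space"
  assumes "L2 M f" "L2 M g"
  shows "integrable M (\<lambda>x. f x \<bullet> g x)"
proof (rule Bochner_Integration.integrable_bound)
  show "integrable M (\<lambda>x. (norm (f x))\<^sup>2 + (norm (g x))\<^sup>2)"
    using assms by (simp add: L2_def)
  show "(\<lambda>x. f x \<bullet> g x) \<in> borel_measurable M"
    using assms by (auto simp: L2_def)
  have "\<bar>f x \<bullet> g x\<bar> \<le> (norm (f x))\<^sup>2 + (norm (g x))\<^sup>2" for x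
    using Cauchy_Schwarz_ineq2[of "f x" "g x"] sum_squares_bound[of "norm (f x)" "norm (g x)"]
      mult_nonneg_nonneg[of "norm (f x)" "norm (g x)"] by linarith
  then show "AE x in M. norm (f x \<bullet> g x) \<le> norm ((norm (f x))\<^sup>2 + (norm (g x))\<^sup>2)"
    by auto
qed

lemma integrable_L2_mult:
  fixes f g :: "'a \<Rightarrow> real"
  shows "L2 M f \<Longrightarrow> L2 M g \<Longrightarrow> integrable M (\<lambda>x. f x * g x)"
  using integrable_L2_inner[of M f g] by simp

lemma l2_norm_nonneg [simp]: "0 \<le> l2_norm M f"
  by (simp add: l2_norm_def)

lemma l2_norm_sq: "(l2_norm M f)\<^sup>2 = (LINT x|M. (norm (f x))\<^sup>2)"
  by (simp add: l2_norm_def)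

lemma l2_norm_eq_0_iff_AE: "L2 M f \<Longrightarrow> l2_norm M f = 0 \<longleftrightarrow> (AE x in M. f x = 0)"
  unfolding l2_norm_def L2_def by (subst real_sqrt_eq_0_iff, subst integral_nonneg_eq_0_iff_AE) auto

text \<open>
  The Cauchy--Schwarz inequality, from the nonnegativity of the quadratic polynomial
  \<open>t \<mapsto> \<parallel>f - t g\<parallel>\<^sup>2\<close> at its minimum \<open>t = (f, g) / \<parallel>g\<parallel>\<^sup>2\<close>.
\<close>

lemma l2_inner_le:
  assumes f: "L2 M f" and g: "L2 M g"
  shows "l2_inner M f g \<le> l2_norm M f * l2_norm M g"
proof -
  have nonneg: "0 \<le> (l2_norm M f)\<^sup>2 - 2 * t * l2_inner M f g + t\<^sup>2 * (l2_norm M g)\<^sup>2" for t :: real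
  proof -
    have *: "(norm (f x - t *\<^sub>R g x))\<^sup>2 = (norm (f x))\<^sup>2 - 2 * t * (f x \<bullet> g x) + t\<^sup>2 * (norm (g x))\<^sup>2" for x
      unfolding power2_norm_eq_inner
      by (simp add: inner_diff_left inner_diff_right inner_commute[of "g x" "f x"] power2_eq_square algebra_simps)
    have "0 \<le> (LINT x|M. (norm (f x - t *\<^sub>R g x))\<^sup>2)" by simp
    also have "\<dots> = (LINT x|M. (norm (f x))\<^sup>2 - 2 * t * (f x \<bullet> g x) + t\<^sup>2 * (norm (g x))\<^sup>2)"
      by (simp only: *)
    also have "\<dots> = (l2_norm M f)\<^sup>2 - 2 * t * l2_inner M f g + t\<^sup>2 * (l2_norm M g)\<^sup>2"
      using f g integrable_L2_inner[OF f g]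
      by (simp add: L2_def l2_norm_sq l2_inner_def)
    finally show ?thesis .
  qed
  show ?thesis
  proof (cases "l2_norm M g = 0")
    case True
    then have "AE x in M. g x = 0" using g l2_norm_eq_0_iff_AE by blast
    then have "l2_inner M f g = 0" unfolding l2_inner_def by (intro integral_eq_zero_AE) auto
    then show ?thesis by simp
  next
    case False
    then have pos: "l2_norm M g > 0" using l2_norm_nonneg[of M g] by linarith
    have "(l2_inner M f g)\<^sup>2 \<le> (l2_norm M f)\<^sup>2 * (l2_norm M g)\<^sup>2"
    proof -
      define q p where "q = l2_inner M f g" and "p = (l2_norm M g)\<^sup>2"
      have "p > 0" using pos by (simp add: p_def)
      have "0 \<le> (l2_norm M f)\<^sup>2 - 2 * (q / p) * q + (q / p)\<^sup>2 * p"
        using nonneg[of "q / p"] by (simp only: p_def q_def)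
      also have "\<dots> = (l2_norm M f)\<^sup>2 - q\<^sup>2 / p"
        using \<open>p > 0\<close> by (simp add: power2_eq_square)
      finally show ?thesis
        using \<open>p > 0\<close> by (simp add: field_simps flip: q_def p_def)
    qed
    then have "\<bar>l2_inner M f g\<bar> \<le> \<bar>l2_norm M f * l2_norm M g\<bar>"
      by (intro power2_le_iff_abs_le[THEN iffD1] abs_le_square_iff[THEN iffD2]) (simp_all add: power_mult_distrib)
    then show ?thesis by simp
  qed
qed

section \<open>Weak gradients\<close>

lemma L2_of_bounded:
  fixes f :: "'a::euclidean_space \<Rightarrow> 'b::euclidean_space"
  assumes "S \<in> lmeasurable" "f \<in> borel_measurable (lebesgue_on S)" "\<And>x. x \<in> S \<Longrightarrow> norm (f x) \<le> B"
  shows "L2 (lebesgue_on S) f"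
proof (rule L2_bound[OF assms(2)])
  show "integrable (lebesgue_on S) (\<lambda>x. B\<^sup>2)"
    using assms(1) by (intro finite_measure.integrable_const) (simp add: finite_measure_lebesgue_on)
  show "(norm (f x))\<^sup>2 \<le> B\<^sup>2" if "x \<in> space (lebesgue_on S)" for x
    using assms(3)[of x] that by (intro power_mono) auto
qed

lemma test_function_support:
  assumes "test_function \<Omega> \<phi>"
  obtains K where "compact K" "K \<subseteq> \<Omega>" "\<And>x. x \<notin> K \<Longrightarrow> \<phi> x = 0" "\<And>x k. x \<notin> K \<Longrightarrow> partial_deriv k \<phi> x = 0"
proof -
  obtain K where K: "compact K" "K \<subseteq> \<Omega>" "\<And>x. x \<notin> K \<Longrightarrow> \<phi> x = 0"
    using assms unfolding test_function_def by blast
  have "partial_deriv k \<phi> x = 0" if "x \<notin> K" for x k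
  proof -
    have "(\<phi> has_derivative (\<lambda>h. 0)) (at x)"
      by (rule has_derivative_transform_within_open[where f = "\<lambda>x. 0" and s = "- K"])
        (use K that compact_imp_closed in auto)
    then show ?thesis by (rule partial_deriv_eqI)
  qed
  with K show ?thesis using that by blast
qed

lemma bounded_of_compact_support:
  fixes f :: "'a::metric_space \<Rightarrow> 'b::real_normed_vector"
  assumes "continuous_on UNIV f" "compact K" "\<And>x. x \<notin> K \<Longrightarrow> f x = 0"
  obtains B where "B \<ge> 0" "\<And>x. norm (f x) \<le> B"
proof -
  have "bounded (f ` K)"
    using assms by (intro compact_imp_bounded compact_continuous_image) (auto intro: continuous_on_subset)
  then obtain B where "\<And>x. x \<in> K \<Longrightarrow> norm (f x) \<le> B" unfolding bounded_iff by blast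
  then have "norm (f x) \<le> max B 0" for x using assms(3)[of x] by (cases "x \<in> K") fastforce+
  then show ?thesis using that[of "max B 0"] by simp
qed

lemma test_function_L2:
  fixes \<Omega> :: "(real^'n) set"
  assumes "\<Omega> \<in> lmeasurable" "test_function \<Omega> \<phi>"
  shows "L2 (lebesgue_on \<Omega>) \<phi>" "L2 (lebesgue_on \<Omega>) (partial_deriv k \<phi>)"
proof -
  obtain K where K: "compact K" "\<And>x. x \<notin> K \<Longrightarrow> \<phi> x = 0" "\<And>x k. x \<notin> K \<Longrightarrow> partial_deriv k \<phi> x = 0"
    using test_function_support[OF assms(2)] by metis
  obtain B where "\<And>x. norm (\<phi> x) \<le> B"
    using bounded_of_compact_support[OF test_function_continuous[OF assms(2)] K(1,2)] by metis
  then show "L2 (lebesgue_on \<Omega>) \<phi>"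
    using assms by (intro L2_of_bounded continuous_borel_lebesgue_on test_function_continuous)
  obtain B where "\<And>x. norm (partial_deriv k \<phi> x) \<le> B"
    using bounded_of_compact_support[OF partial_deriv_continuous[OF assms(2)] K(1,3)] by metis
  then show "L2 (lebesgue_on \<Omega>) (partial_deriv k \<phi>)"
    using assms by (intro L2_of_bounded continuous_borel_lebesgue_on partial_deriv_continuous)
qed

lemma has_weak_grad_add:
  fixes \<Omega> :: "(real^'n) set"
  assumes "\<Omega> \<in> lmeasurable" "L2 (lebesgue_on \<Omega>) v" "L2 (lebesgue_on \<Omega>) w"
    "L2 (lebesgue_on \<Omega>) G" "L2 (lebesgue_on \<Omega>) F"
    "has_weak_grad \<Omega> v G" "has_weak_grad \<Omega> w F"
  shows "has_weak_grad \<Omega> (\<lambda>x. v x + w x) (\<lambda>x. G x + F x)"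
  unfolding has_weak_grad_def
proof (intro allI impI)
  fix \<phi> k l assume \<phi>: "test_function \<Omega> \<phi>"
  note L2 = test_function_L2[OF assms(1) \<phi>]
  have "integrable (lebesgue_on \<Omega>) (\<lambda>x. v x $ l * partial_deriv k \<phi> x)"
    "integrable (lebesgue_on \<Omega>) (\<lambda>x. w x $ l * partial_deriv k \<phi> x)"
    "integrable (lebesgue_on \<Omega>) (\<lambda>x. G x $ k $ l * \<phi> x)"
    "integrable (lebesgue_on \<Omega>) (\<lambda>x. F x $ k $ l * \<phi> x)"
    by (intro integrable_L2_mult L2_vec_nth assms L2)+
  then show "(LINT x|lebesgue_on \<Omega>. (v x + w x) $ l * partial_deriv k \<phi> x) =
        - (LINT x|lebesgue_on \<Omega>. (G x + F x) $ k $ l * \<phi> x)"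
    using assms(6,7) \<phi> by (simp add: distrib_right has_weak_grad_def)
qed

lemma has_weak_grad_scaleR:
  assumes "has_weak_grad \<Omega> v G"
  shows "has_weak_grad \<Omega> (\<lambda>x. c *\<^sub>R v x) (\<lambda>x. c *\<^sub>R G x)"
  using assms unfolding has_weak_grad_def by (simp add: mult.assoc)

text \<open>
  Every entry of the difference of two weak gradients is orthogonal to all test functions. The
  selected representative \<^const>\<open>weak_grad\<close> is therefore linear in the function up to null sets, which
  is what makes the elastic form bilinear.
\<close>

lemma has_weak_grad_unique:
  fixes \<Omega> :: "(real^'n) set"
  assumes "open \<Omega>" "bounded \<Omega>" and v: "has_weak_grad \<Omega> v G" "has_weak_grad \<Omega> v F"
    and L2: "L2 (lebesgue_on \<Omega>) G" "L2 (lebesgue_on \<Omega>) F"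
  shows "AE x in lebesgue_on \<Omega>. G x = F x"
proof -
  have meas: "\<Omega> \<in> lmeasurable" using assms(1,2) by (simp add: lmeasurable_open)
  have one: "L2 (lebesgue_on \<Omega>) (\<lambda>x. 1::real)"
    using meas by (intro L2_of_bounded[where B=1]) auto
  have "AE x in lebesgue_on \<Omega>. G x $ k $ l - F x $ k $ l = 0" for k l
  proof (rule AE_eq_0_if_orthogonal_to_test_functions[OF \<open>open \<Omega>\<close>])
    show "integrable (lebesgue_on \<Omega>) (\<lambda>x. G x $ k $ l - F x $ k $ l)"
      using integrable_L2_mult[OF L2_vec_nth[OF L2_vec_nth[OF L2(1)]] one]
        integrable_L2_mult[OF L2_vec_nth[OF L2_vec_nth[OF L2(2)]] one] by simp
    fix \<phi> assume \<phi>: "test_function \<Omega> \<phi>"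
    have "integrable (lebesgue_on \<Omega>) (\<lambda>x. G x $ k $ l * \<phi> x)"
      "integrable (lebesgue_on \<Omega>) (\<lambda>x. F x $ k $ l * \<phi> x)"
      by (intro integrable_L2_mult L2_vec_nth L2 test_function_L2[OF meas \<phi>])+
    moreover have "(LINT x|lebesgue_on \<Omega>. G x $ k $ l * \<phi> x) = (LINT x|lebesgue_on \<Omega>. F x $ k $ l * \<phi> x)"
      using v(1)[unfolded has_weak_grad_def, rule_format, OF \<phi>, where k = k and l = l]
        v(2)[unfolded has_weak_grad_def, rule_format, OF \<phi>, where k = k and l = l] by simp
    ultimately show "(LINT x|lebesgue_on \<Omega>. (G x $ k $ l - F x $ k $ l) * \<phi> x) = 0"
      by (simp add: left_diff_distrib)
  qed
  then have "AE x in lebesgue_on \<Omega>. \<forall>k l. G x $ k $ l - F x $ k $ l = 0"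
    by (simp add: AE_all_countable)
  then show ?thesis by eventually_elim (simp add: vec_eq_iff)
qed

locale bounded_open_set =
  fixes \<Omega> :: "(real^'n) set"
  assumes open_\<Omega>: "open \<Omega>" and bounded_\<Omega>: "bounded \<Omega>"
begin

lemma lmeasurable_\<Omega>: "\<Omega> \<in> lmeasurable"
  using open_\<Omega> bounded_\<Omega> by (simp add: lmeasurable_open)

lemma weak_grad:
  assumes "v \<in> H1 \<Omega>"
  shows "L2 (lebesgue_on \<Omega>) (weak_grad \<Omega> v)" "has_weak_grad \<Omega> v (weak_grad \<Omega> v)"
proof -
  have "\<exists>G. L2 (lebesgue_on \<Omega>) G \<and> has_weak_grad \<Omega> v G" using assms by (simp add: H1_def)
  from someI_ex[OF this, folded weak_grad_def]
  show "L2 (lebesgue_on \<Omega>) (weak_grad \<Omega> v)" "has_weak_grad \<Omega> v (weak_grad \<Omega> v)"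
    by (rule conjunct1, rule conjunct2)
qed

lemma H1_I: "L2 (lebesgue_on \<Omega>) v \<Longrightarrow> L2 (lebesgue_on \<Omega>) G \<Longrightarrow> has_weak_grad \<Omega> v G \<Longrightarrow> v \<in> H1 \<Omega>"
  by (auto simp: H1_def)

lemma H1_L2: "v \<in> H1 \<Omega> \<Longrightarrow> L2 (lebesgue_on \<Omega>) v"
  by (simp add: H1_def)

lemma weak_grad_AE_eq:
  assumes "L2 (lebesgue_on \<Omega>) v" "L2 (lebesgue_on \<Omega>) G" "has_weak_grad \<Omega> v G"
  shows "AE x in lebesgue_on \<Omega>. weak_grad \<Omega> v x = G x"
  using has_weak_grad_unique[OF open_\<Omega> bounded_\<Omega> weak_grad(2)[OF H1_I[OF assms]] assms(3)
      weak_grad(1)[OF H1_I[OF assms]] assms(2)] .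

lemma H1_add:
  assumes "v \<in> H1 \<Omega>" "w \<in> H1 \<Omega>"
  shows "(\<lambda>x. v x + w x) \<in> H1 \<Omega>"
    "AE x in lebesgue_on \<Omega>. weak_grad \<Omega> (\<lambda>x. v x + w x) x = weak_grad \<Omega> v x + weak_grad \<Omega> w x"
proof -
  note * = L2_add[OF H1_L2[OF assms(1)] H1_L2[OF assms(2)]]
    L2_add[OF weak_grad(1)[OF assms(1)] weak_grad(1)[OF assms(2)]]
    has_weak_grad_add[OF lmeasurable_\<Omega> H1_L2[OF assms(1)] H1_L2[OF assms(2)]
      weak_grad(1)[OF assms(1)] weak_grad(1)[OF assms(2)] weak_grad(2)[OF assms(1)] weak_grad(2)[OF assms(2)]]
  show "(\<lambda>x. v x + w x) \<in> H1 \<Omega>" by (rule H1_I[OF *])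
  show "AE x in lebesgue_on \<Omega>. weak_grad \<Omega> (\<lambda>x. v x + w x) x = weak_grad \<Omega> v x + weak_grad \<Omega> w x" by (rule weak_grad_AE_eq[OF *])
qed

lemma H1_scaleR:
  assumes "v \<in> H1 \<Omega>"
  shows "(\<lambda>x. c *\<^sub>R v x) \<in> H1 \<Omega>"
    "AE x in lebesgue_on \<Omega>. weak_grad \<Omega> (\<lambda>x. c *\<^sub>R v x) x = c *\<^sub>R weak_grad \<Omega> v x"
proof -
  note * = L2_scaleR[OF H1_L2[OF assms], of c] L2_scaleR[OF weak_grad(1)[OF assms], of c]
    has_weak_grad_scaleR[OF weak_grad(2)[OF assms], of c]
  show "(\<lambda>x. c *\<^sub>R v x) \<in> H1 \<Omega>" by (rule H1_I[OF *])
  show "AE x in lebesgue_on \<Omega>. weak_grad \<Omega> (\<lambda>x. c *\<^sub>R v x) x = c *\<^sub>R weak_grad \<Omega> v x" by (rule weak_grad_AE_eq[OF *])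
qed

end

section \<open>Piecewise affine functions have weak gradients\<close>

text \<open>
  Row \<open>k\<close> of a weak gradient holds the derivatives in direction \<open>k\<close>, hence the transpose of the
  Jacobian. The value on the cell boundaries, a null set, is arbitrary.
\<close>

definition piecewise_grad :: "(real^'n) set set \<Rightarrow> (real^'n \<Rightarrow> real^'n) \<Rightarrow> real^'n \<Rightarrow> real^'n^'n" where
  "piecewise_grad \<T> v x =
     (if x \<in> (\<Union>T\<in>\<T>. interior T) then transpose (matrix (frechet_derivative v (at x))) else 0)"

lemma affine_on_has_derivative:
  fixes v :: "real^'n \<Rightarrow> real^'n"
  assumes "\<And>x. x \<in> T \<Longrightarrow> v x = M *v x + c" "x \<in> interior T"
  shows "(v has_derivative (\<lambda>h. M *v h)) (at x)"
proof (rule has_derivative_transform_within_open[where f = "\<lambda>x. M *v x + c" and s = "interior T"])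
  show "((\<lambda>x. M *v x + c) has_derivative (\<lambda>h. M *v h)) (at x)"
    by (auto intro!: derivative_eq_intros bounded_linear.has_derivative[OF matrix_vector_mul_bounded_linear])
qed (use assms interior_subset[of T] in auto)

lemma piecewise_grad_interior:
  assumes "\<And>x. x \<in> T \<Longrightarrow> v x = M *v x + c" "x \<in> interior T" "T \<in> \<T>"
  shows "piecewise_grad \<T> v x = transpose M"
proof -
  have "frechet_derivative v (at x) = (\<lambda>h. M *v h)"
    using frechet_derivative_at[OF affine_on_has_derivative[OF assms(1,2)]] by simp
  then show ?thesis using assms(2,3) by (auto simp: piecewise_grad_def)
qed

text \<open>
  The domain need not be convex, so a Lipschitz bound for a piecewise affine function can only be
  expected between points whose segment stays inside; there the cells cut the segment into finitely
  many closed pieces.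
\<close>

lemma lipschitz_along_segment:
  fixes v :: "'a::real_normed_vector \<Rightarrow> 'b::real_normed_vector"
  assumes "finite \<T>" "\<And>T. T \<in> \<T> \<Longrightarrow> closed T" "closed_segment x y \<subseteq> \<Union>\<T>"
    and lip: "\<And>T. T \<in> \<T> \<Longrightarrow> L-lipschitz_on T v" and L: "L \<ge> 0"
  shows "norm (v y - v x) \<le> L * norm (y - x)"
proof -
  define p where "p s = x + s *\<^sub>R (y - x)" for s :: real
  have p: "continuous_on S p" for S unfolding p_def by (intro continuous_intros)
  have dist_p: "dist (p s) (p t) = norm (y - x) * dist s t" for s t
  proof -
    have "p s - p t = (s - t) *\<^sub>R (y - x)" by (simp add: p_def scaleR_left_diff_distrib)
    then show ?thesis by (simp add: dist_norm)
  qed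
  have "(L * norm (y - x))-lipschitz_on {0..1} (v \<circ> p)"
  proof (rule lipschitz_on_closed_Union[where U = "\<lambda>T. {0..1} \<inter> p -` T" and I = \<T>])
    fix T assume T: "T \<in> \<T>"
    show "closed ({0..1} \<inter> p -` T)"
      using p assms(2)[OF T] by (intro continuous_closed_preimage) auto
    show "(L * norm (y - x))-lipschitz_on ({0..1} \<inter> p -` T) (v \<circ> p)"
    proof (rule lipschitz_onI)
      fix s t assume "s \<in> {0..1} \<inter> p -` T" "t \<in> {0..1} \<inter> p -` T"
      then have "dist (v (p s)) (v (p t)) \<le> L * dist (p s) (p t)"
        using lip[OF T] by (intro lipschitz_onD) auto
      then show "dist ((v \<circ> p) s) ((v \<circ> p) t) \<le> L * norm (y - x) * dist s t"
        by (simp add: dist_p mult.assoc)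
    qed (use L in auto)
  next
    have "p s \<in> \<Union>\<T>" if "s \<in> {0..1}" for s
    proof -
      have "p s \<in> closed_segment x y"
        using that unfolding closed_segment_def p_def
        by (intro CollectI exI[of _ s]) (simp add: algebra_simps)
      then show ?thesis using assms(3) by blast
    qed
    then show "{0..1} \<subseteq> (\<Union>T\<in>\<T>. {0..1} \<inter> p -` T)" by blast
  qed (use assms in auto)
  then have "dist ((v \<circ> p) 1) ((v \<circ> p) 0) \<le> L * norm (y - x) * dist (1::real) 0"
    by (rule lipschitz_onD) auto
  then show ?thesis by (simp add: p_def dist_norm)
qed

lemma integral_lborel_translate:
  fixes F :: "'a::euclidean_space \<Rightarrow> real"
  assumes "F \<in> borel_measurable borel"
  shows "(LINT x|lborel. F (x + c)) = (LINT x|lborel. F x)"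
proof -
  have "(LINT x|lborel. F x) = (LINT x|distr lborel borel ((+) c). F x)"
    by (simp add: lborel_distr_plus)
  also have "\<dots> = (LINT x|lborel. F (x + c))"
    using assms by (subst integral_distr) (auto simp: add.commute)
  finally show ?thesis by simp
qed

lemma integrable_lborel_translate:
  fixes F :: "'a::euclidean_space \<Rightarrow> real"
  assumes "integrable lborel F"
  shows "integrable lborel (\<lambda>x. F (x + c))"
proof -
  have "integrable (distr lborel borel ((+) c)) F"
    using assms by (simp add: lborel_distr_plus)
  then show ?thesis
    by (subst (asm) integrable_distr_eq) (use assms in \<open>auto simp: add.commute\<close>)
qed

lemma integrable_lborel_of_compact_support:
  fixes F :: "'a::euclidean_space \<Rightarrow> real"
  assumes "F \<in> borel_measurable borel" "compact K" "\<And>x. x \<notin> K \<Longrightarrow> F x = 0" "\<And>x. \<bar>F x\<bar> \<le> B"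
  shows "integrable lborel F"
proof (rule Bochner_Integration.integrable_bound)
  show "integrable lborel (\<lambda>x. B * indicator K x)"
    using assms(2) emeasure_bounded_finite[OF compact_imp_bounded[OF assms(2)]]
    by (intro integrable_mult_right integrable_real_indicator) (auto simp: compact_imp_closed borel_closed)
  have "\<bar>F x\<bar> \<le> \<bar>B * indicator K x\<bar>" for x
    using assms(3)[of x] assms(4)[of x] by (cases "x \<in> K") auto
  then show "AE x in lborel. norm (F x) \<le> norm (B * indicator K x)" by simp
qed (use assms in auto)

text \<open>
  By translation invariance the difference quotients of \<open>F\<close> in direction \<open>e\<close> integrate to zero. The
  Lipschitz bound and the compact support dominate them, so their limit integrates to zero as well.
  This replaces integration by parts over the individual simplices: no boundary integrals and no
  normal vectors appear.
\<close>

lemma integral_directional_derivative_eq_0: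
  fixes F F' :: "'a::euclidean_space \<Rightarrow> real"
  assumes F: "F \<in> borel_measurable borel" and F': "F' \<in> borel_measurable borel"
    and K: "compact K" "\<And>x. x \<notin> K \<Longrightarrow> F x = 0" and bounded: "\<And>x. \<bar>F x\<bar> \<le> B"
    and \<delta>: "\<delta> > 0" and lip: "\<And>x t. \<bar>t\<bar> < \<delta> \<Longrightarrow> \<bar>F (x + t *\<^sub>R e) - F x\<bar> \<le> C * \<bar>t\<bar>"
    and deriv: "AE x in lborel. ((\<lambda>t. F (x + t *\<^sub>R e)) has_real_derivative F' x) (at 0)"
  shows "(LINT x|lborel. F' x) = 0"
proof -
  have intF: "integrable lborel F"
    by (rule integrable_lborel_of_compact_support[OF F K bounded])
  \<comment> \<open>Adding 2 keeps the steps positive and below the Lipschitz range \<open>\<delta>\<close> already for \<open>n = 0\<close>.\<close>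
  define t where "t n = \<delta> / (real n + 2)" for n
  have t: "0 < t n" "t n < \<delta>" "t n \<noteq> 0" for n using \<delta> by (auto simp: t_def field_simps add_pos_nonneg)
  have tlim: "t \<longlonglongrightarrow> 0" unfolding t_def by real_asymp
  obtain R where R: "K \<subseteq> cball 0 R"
    using compact_imp_bounded[OF K(1)] unfolding bounded_iff by (auto simp: subset_eq)
  define D where "D n x = (F (x + t n *\<^sub>R e) - F x) / t n" for n x
  have D0: "(LINT x|lborel. D n x) = 0" for n
    unfolding D_def using integrable_lborel_translate[OF intF] intF
    by (simp add: integral_lborel_translate[OF F])
  have Dm: "D n \<in> borel_measurable lborel" for n
    unfolding D_def using F by measurable
  have "(\<lambda>n. LINT x|lborel. D n x) \<longlonglongrightarrow> (LINT x|lborel. F' x)"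
  proof (rule integral_dominated_convergence[where w = "\<lambda>x. C * indicator (cball 0 (R + \<delta> * norm e)) x"])
    show "integrable lborel (\<lambda>x::'a. C * indicator (cball 0 (R + \<delta> * norm e)) x)"
      using emeasure_bounded_finite[OF bounded_cball[of "0::'a" "R + \<delta> * norm e"]]
      by (intro integrable_mult_right integrable_real_indicator) auto
    have "norm (D n x) \<le> C * indicator (cball 0 (R + \<delta> * norm e)) x" for n x
    proof (cases "x \<in> cball 0 (R + \<delta> * norm e)")
      case True
      have "\<bar>F (x + t n *\<^sub>R e) - F x\<bar> \<le> C * t n" using lip[of "t n" x] t(1,2)[of n] by simp
      then show ?thesis using True t(1)[of n] by (simp add: D_def field_simps)
    next
      case False
      then have nx: "norm x > R + \<delta> * norm e" by simp
      have "norm x \<le> norm (x + t n *\<^sub>R e) + norm (t n *\<^sub>R e)"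
        using norm_triangle_ineq4[of "x + t n *\<^sub>R e" "t n *\<^sub>R e"] by simp
      moreover have "norm (t n *\<^sub>R e) \<le> \<delta> * norm e" using t[of n] by (simp add: mult_right_mono)
      moreover have "0 \<le> \<delta> * norm e" using \<delta> by simp
      ultimately have "norm (x + t n *\<^sub>R e) > R" "norm x > R" using nx by linarith+
      then have "x + t n *\<^sub>R e \<notin> K" "x \<notin> K" using R by force+
      then show ?thesis using False by (simp add: D_def K(2))
    qed
    then show "AE x in lborel. norm (D n x) \<le> C * indicator (cball 0 (R + \<delta> * norm e)) x" for n by simp
    show "AE x in lborel. (\<lambda>n. D n x) \<longlonglongrightarrow> F' x"
      using deriv
    proof eventually_elim
      case (elim x)
      then have "((\<lambda>h. (F (x + h *\<^sub>R e) - F x) / h) \<longlongrightarrow> F' x) (at 0)"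
        by (simp add: DERIV_def)
      moreover have "filterlim t (at 0) sequentially"
        using tlim t(3) by (simp add: filterlim_at)
      ultimately show ?case unfolding D_def by (rule filterlim_compose)
    qed
  qed (use Dm F' in auto)
  then show ?thesis by (simp add: D0 LIMSEQ_const_iff)
qed

lemma partial_deriv_DERIV:
  assumes "test_function \<Omega> \<phi>"
  shows "((\<lambda>t. \<phi> (x + t *\<^sub>R axis k 1)) has_real_derivative partial_deriv k \<phi> (x + s *\<^sub>R axis k 1)) (at s)"
proof -
  have 1: "(\<phi> has_derivative frechet_derivative \<phi> (at (x + s *\<^sub>R axis k 1))) (at (x + s *\<^sub>R axis k 1))"
    using test_function_differentiable[OF assms] frechet_derivative_works by blast
  have "((\<lambda>t. \<phi> (x + t *\<^sub>R axis k 1)) has_derivative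
      (\<lambda>h. frechet_derivative \<phi> (at (x + s *\<^sub>R axis k 1)) (h *\<^sub>R axis k 1))) (at s)"
    by (rule has_derivative_compose[where f = "\<lambda>t. x + t *\<^sub>R axis k 1"
          and f' = "\<lambda>h. h *\<^sub>R axis k 1", OF _ 1]) (auto intro!: derivative_eq_intros)
  then show ?thesis
    unfolding has_field_derivative_def partial_deriv_def
    by (rule has_derivative_eq_rhs)
      (auto simp: linear_scale[OF has_derivative_linear[OF 1]])
qed

lemma test_function_lipschitz:
  assumes "test_function \<Omega> \<phi>" and B: "\<And>x. \<bar>partial_deriv k \<phi> x\<bar> \<le> B"
  shows "\<bar>\<phi> (x + t *\<^sub>R axis k 1) - \<phi> x\<bar> \<le> B * \<bar>t\<bar>"
  using field_differentiable_bound[of UNIV "\<lambda>t. \<phi> (x + t *\<^sub>R axis k 1)"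
      "\<lambda>t. partial_deriv k \<phi> (x + t *\<^sub>R axis k 1)" B t 0] partial_deriv_DERIV[OF assms(1)] B
  by simp


locale triangulated_domain = bounded_open_set \<Omega> for \<Omega> :: "(real^'n) set" +
  fixes \<T> :: "(real^'n) set set"
  assumes finite_\<T>: "finite \<T>" and Union_\<T>: "\<Union>\<T> = closure \<Omega>"
    and closed_\<T>: "\<And>T. T \<in> \<T> \<Longrightarrow> closed T" and convex_\<T>: "\<And>T. T \<in> \<T> \<Longrightarrow> convex T"
begin

lemma affine_fe_coeffs:
  assumes "v \<in> affine_fe \<Omega> \<T>"
  obtains M c where "\<And>T x. T \<in> \<T> \<Longrightarrow> x \<in> T \<Longrightarrow> v x = M T *v x + c T"
proof -
  have "\<forall>T\<in>\<T>. \<exists>(M :: real^'n^'n) c. \<forall>x\<in>T. v x = M *v x + c" using assms by (simp add: affine_fe_def)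
  then show ?thesis using that by metis
qed

lemma AE_interior_cells: "AE x in lborel. x \<in> \<Omega> \<longrightarrow> x \<in> (\<Union>T\<in>\<T>. interior T)"
proof -
  have "negligible (\<Union>T\<in>\<T>. frontier T)"
    using finite_\<T> by (intro negligible_Union) (auto intro: negligible_convex_frontier convex_\<T>)
  then have "(\<Union>T\<in>\<T>. frontier T) \<in> null_sets lborel"
  proof -
    have "(\<Union>T\<in>\<T>. frontier T) \<in> sets lborel"
      using finite_\<T> by (auto intro!: borel_closed closed_UN)
    with \<open>negligible _\<close> show ?thesis
      by (simp add: negligible_iff_null_sets null_sets_completion_iff)
  qed
  then have "AE x in lborel. x \<notin> (\<Union>T\<in>\<T>. frontier T)" by (rule AE_not_in)
  then show ?thesis
  proof eventually_elim
    case (elim x)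
    show ?case
    proof
      assume "x \<in> \<Omega>"
      then obtain T where "T \<in> \<T>" "x \<in> T" using Union_\<T> closure_subset by blast
      then show "x \<in> (\<Union>T\<in>\<T>. interior T)"
        using elim closed_\<T>[of T] by (auto simp: frontier_def)
    qed
  qed
qed

lemma bounded_affine_fe:
  assumes "v \<in> affine_fe \<Omega> \<T>"
  obtains B where "B \<ge> 0" "\<And>x. norm (v x) \<le> B"
proof -
  have "compact (v ` closure \<Omega>)"
    using assms bounded_\<Omega> by (intro compact_continuous_image) (auto simp: affine_fe_def)
  then have "bounded (v ` closure \<Omega>)" by (rule compact_imp_bounded)
  then obtain B where "\<And>x. x \<in> closure \<Omega> \<Longrightarrow> norm (v x) \<le> B"
    unfolding bounded_iff by blast
  moreover have "v x = 0" if "x \<notin> closure \<Omega>" for x using assms that by (simp add: affine_fe_def)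
  ultimately have "norm (v x) \<le> max B 0" for x
    by (cases "x \<in> closure \<Omega>") (auto simp: le_max_iff_disj)
  then show ?thesis using that[of "max B 0"] by simp
qed

lemma affine_fe_lipschitz:
  assumes v: "v \<in> affine_fe \<Omega> \<T>"
  obtains L where "L \<ge> 0" "\<And>x y. closed_segment x y \<subseteq> \<Omega> \<Longrightarrow> norm (v y - v x) \<le> L * norm (y - x)"
proof -
  obtain M c where M: "\<And>T x. T \<in> \<T> \<Longrightarrow> x \<in> T \<Longrightarrow> v x = M T *v x + c T"
    using affine_fe_coeffs[OF v] by metis
  define L where "L = (\<Sum>T\<in>\<T>. onorm (\<lambda>h. M T *v h))"
  have L: "L \<ge> 0" unfolding L_def by (intro sum_nonneg onorm_pos_le matrix_vector_mul_bounded_linear)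
  have "L-lipschitz_on T v" if T: "T \<in> \<T>" for T
  proof (rule lipschitz_onI)
    fix x y assume "x \<in> T" "y \<in> T"
    then have "dist (v x) (v y) = norm (M T *v (x - y))"
      using M[OF T] by (simp add: dist_norm matrix_vector_mult_diff_distrib)
    also have "\<dots> \<le> onorm (\<lambda>h. M T *v h) * norm (x - y)"
      by (rule onorm[OF matrix_vector_mul_bounded_linear])
    also have "\<dots> \<le> L * norm (x - y)"
      unfolding L_def using finite_\<T> T
      by (intro mult_right_mono member_le_sum onorm_pos_le matrix_vector_mul_bounded_linear) auto
    finally show "dist (v x) (v y) \<le> L * dist x y" by (simp add: dist_norm)
  qed (use L in auto)
  then show ?thesis
    using lipschitz_along_segment[OF finite_\<T> closed_\<T> _ _ L, of _ _ v] Union_\<T> closure_subset L that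
    by (metis subset_trans)
qed

lemma piecewise_grad_measurable:
  assumes v: "v \<in> affine_fe \<Omega> \<T>"
  shows "piecewise_grad \<T> v \<in> borel_measurable borel"
proof -
  obtain M c where M: "\<And>T x. T \<in> \<T> \<Longrightarrow> x \<in> T \<Longrightarrow> v x = M T *v x + c T"
    using affine_fe_coeffs[OF v] by metis
  have G: "piecewise_grad \<T> v x = transpose (M T)" if "T \<in> \<T>" "x \<in> interior T" for x T
    using piecewise_grad_interior[OF M] that by blast
  show ?thesis
  proof (rule measurableI)
    fix S :: "(real^'n^'n) set"
    have "x \<in> piecewise_grad \<T> v -` S \<inter> space borel \<longleftrightarrow>
       x \<in> (\<Union>T\<in>{T\<in>\<T>. transpose (M T) \<in> S}. interior T) \<union> (if 0 \<in> S then - (\<Union>T\<in>\<T>. interior T) else {})"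
      for x
    proof (cases "x \<in> (\<Union>T\<in>\<T>. interior T)")
      case True
      then obtain T where T: "T \<in> \<T>" "x \<in> interior T" by blast
      have eq: "transpose (M T') = transpose (M T)" if "T' \<in> \<T>" "x \<in> interior T'" for T'
        using trans[OF G[OF that, symmetric] G[OF T]] .
      have "x \<in> (\<Union>T\<in>{T\<in>\<T>. transpose (M T) \<in> S}. interior T) \<longleftrightarrow> transpose (M T) \<in> S"
      proof
        assume "x \<in> (\<Union>T\<in>{T\<in>\<T>. transpose (M T) \<in> S}. interior T)"
        then obtain T' where "T' \<in> \<T>" "x \<in> interior T'" "transpose (M T') \<in> S" by blast
        then show "transpose (M T) \<in> S" using eq by simp
      qed (use T in blast)
      then show ?thesis using True by (auto simp: G[OF T])
    next
      case False
      then show ?thesis by (auto simp: piecewise_grad_def)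
    qed
    then have "piecewise_grad \<T> v -` S \<inter> space borel =
       (\<Union>T\<in>{T\<in>\<T>. transpose (M T) \<in> S}. interior T) \<union> (if 0 \<in> S then - (\<Union>T\<in>\<T>. interior T) else {})"
      by blast
    also have "\<dots> \<in> sets borel"
    proof -
      have *: "(\<Union>T\<in>\<S>. interior T) \<in> sets borel" for \<S> :: "(real^'n) set set"
        by (intro borel_open open_UN) auto
      show ?thesis using *[of \<T>] by (intro sets.Un *) (simp del: Compl_UN add: borel_comp)
    qed
    finally show "piecewise_grad \<T> v -` S \<inter> space borel \<in> sets borel" .
  qed auto
qed

lemma piecewise_grad_L2:
  assumes v: "v \<in> affine_fe \<Omega> \<T>"
  shows "L2 (lebesgue_on \<Omega>) (piecewise_grad \<T> v)"
proof -
  obtain M c where M: "\<And>T x. T \<in> \<T> \<Longrightarrow> x \<in> T \<Longrightarrow> v x = M T *v x + c T"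
    using affine_fe_coeffs[OF v] by metis
  have "norm (piecewise_grad \<T> v x) \<le> (\<Sum>T\<in>\<T>. norm (transpose (M T)))" for x
  proof (cases "x \<in> (\<Union>T\<in>\<T>. interior T)")
    case True
    then obtain T where T: "T \<in> \<T>" "x \<in> interior T" by blast
    then have "piecewise_grad \<T> v x = transpose (M T)"
      using piecewise_grad_interior[OF M] by blast
    then show ?thesis using T(1) finite_\<T> by (auto intro: member_le_sum)
  qed (auto simp: piecewise_grad_def sum_nonneg)
  then show ?thesis
    using measurable_restrict_space1[OF measurable_completion[of _ lborel], of _ borel]
      piecewise_grad_measurable[OF v]
    by (intro L2_of_bounded[OF lmeasurable_\<Omega>]) auto
qed

lemma affine_fe_L2:
  assumes v: "v \<in> affine_fe \<Omega> \<T>"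
  shows "L2 (lebesgue_on \<Omega>) v"
proof -
  obtain B where B: "\<And>x. norm (v x) \<le> B" using bounded_affine_fe[OF v] by metis
  have "continuous_on \<Omega> v" using v closure_subset by (auto simp: affine_fe_def intro: continuous_on_subset)
  then have "v \<in> borel_measurable (lebesgue_on \<Omega>)"
    using lmeasurable_\<Omega> by (intro continuous_imp_measurable_on_sets_lebesgue) auto
  then show ?thesis using B by (intro L2_of_bounded[OF lmeasurable_\<Omega>])
qed

text \<open>
  The function \<open>v\<close>, extended by zero, may jump across the boundary of \<open>\<Omega>\<close>, but multiplied by \<open>\<phi>\<close> it becomes Lipschitz
  for steps shorter than the distance \<open>\<delta>\<close> of the support of \<open>\<phi>\<close> to the complement of \<open>\<Omega>\<close>: a step that
  starts or ends in the support stays in \<open>\<Omega>\<close>, and any other step has \<open>\<phi> = 0\<close> at both ends.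
\<close>

lemma affine_fe_product_lipschitz:
  assumes v: "v \<in> affine_fe \<Omega> \<T>" and \<phi>: "test_function \<Omega> \<phi>"
  obtains \<delta> C where "\<delta> > 0"
    "\<And>x t. \<bar>t\<bar> < \<delta> \<Longrightarrow>
       \<bar>v (x + t *\<^sub>R axis k 1) $ l * \<phi> (x + t *\<^sub>R axis k 1) - v x $ l * \<phi> x\<bar> \<le> C * \<bar>t\<bar>"
proof -
  obtain K where K: "compact K" "K \<subseteq> \<Omega>" "\<And>x. x \<notin> K \<Longrightarrow> \<phi> x = 0"
      "\<And>x k. x \<notin> K \<Longrightarrow> partial_deriv k \<phi> x = 0"
    using test_function_support[OF \<phi>] by metis
  obtain B where B: "B \<ge> 0" "\<And>x. norm (\<phi> x) \<le> B"
    using bounded_of_compact_support[OF test_function_continuous[OF \<phi>] K(1,3)] by metis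
  obtain B' where B': "\<And>x. norm (partial_deriv k \<phi> x) \<le> B'"
    using bounded_of_compact_support[OF partial_deriv_continuous[OF \<phi>] K(1,4)] by metis
  obtain N where N: "N \<ge> 0" "\<And>x. norm (v x) \<le> N" using bounded_affine_fe[OF v] by metis
  obtain L where L: "L \<ge> 0" "\<And>x y. closed_segment x y \<subseteq> \<Omega> \<Longrightarrow> norm (v y - v x) \<le> L * norm (y - x)"
    using affine_fe_lipschitz[OF v] by metis
  obtain \<delta> where \<delta>: "\<delta> > 0" "(\<Union>x\<in>K. ball x \<delta>) \<subseteq> \<Omega>"
    using compact_subset_open_imp_ball_epsilon_subset[OF K(1) open_\<Omega> K(2)] by metis
  have "\<bar>v (x + t *\<^sub>R axis k 1) $ l * \<phi> (x + t *\<^sub>R axis k 1) - v x $ l * \<phi> x\<bar> \<le> (L * B + N * B') * \<bar>t\<bar>"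
    if t: "\<bar>t\<bar> < \<delta>" for x t
  proof -
    define y where "y = x + t *\<^sub>R axis k (1::real)"
    have yx: "norm (y - x) = \<bar>t\<bar>" by (simp add: y_def)
    have "\<bar>v y $ l * \<phi> y - v x $ l * \<phi> x\<bar> \<le> (L * B + N * B') * \<bar>t\<bar>"
    proof (cases "x \<in> K \<or> y \<in> K")
      case False
      have "0 \<le> B'" using B'[of x] norm_ge_zero order_trans by blast
      then show ?thesis using False K(3) L(1) B(1) N(1) by simp
    next
      case True
      have "closed_segment x y \<subseteq> \<Omega>"
      proof -
        from True obtain z where z: "z \<in> K" "x \<in> ball z \<delta>" "y \<in> ball z \<delta>"
          using yx t \<delta>(1) by (auto simp: dist_norm norm_minus_commute)
        then have "closed_segment x y \<subseteq> ball z \<delta>" by (simp add: closed_segment_subset)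
        then show ?thesis using z(1) \<delta>(2) by blast
      qed
      then have 1: "\<bar>(v y - v x) $ l\<bar> \<le> L * \<bar>t\<bar>"
        using L(2)[of x y] component_le_norm_cart[of "v y - v x" l] yx by simp
      have 2: "\<bar>\<phi> y - \<phi> x\<bar> \<le> B' * \<bar>t\<bar>"
        unfolding y_def using B' by (intro test_function_lipschitz[OF \<phi>]) auto
      have 3: "\<bar>v x $ l\<bar> \<le> N" using component_le_norm_cart[of "v x" l] N(2)[of x] by simp
      have "\<bar>v y $ l * \<phi> y - v x $ l * \<phi> x\<bar> = \<bar>(v y - v x) $ l * \<phi> y + v x $ l * (\<phi> y - \<phi> x)\<bar>"
        by (simp add: algebra_simps)
      also have "\<dots> \<le> \<bar>(v y - v x) $ l\<bar> * \<bar>\<phi> y\<bar> + \<bar>v x $ l\<bar> * \<bar>\<phi> y - \<phi> x\<bar>"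
        by (metis abs_mult abs_triangle_ineq)
      also have "\<dots> \<le> (L * \<bar>t\<bar>) * B + N * (B' * \<bar>t\<bar>)"
        using 1 2 3 B(2)[of y] by (intro add_mono mult_mono) (auto simp: L N)
      finally show ?thesis by (simp add: algebra_simps)
    qed
    then show ?thesis by (simp only: y_def)
  qed
  then show ?thesis using that \<delta>(1) by blast
qed

text \<open>
  For a test function \<open>\<phi>\<close> the product rule holds at all points interior to a cell, that is, almost
  everywhere, and the integral of the derivative of \<open>v\<^sub>l \<phi>\<close> vanishes by
  \<open>integral_directional_derivative_eq_0\<close>.
\<close>

lemma has_weak_grad_affine_fe:
  assumes v: "v \<in> affine_fe \<Omega> \<T>"
  shows "has_weak_grad \<Omega> v (piecewise_grad \<T> v)"
  unfolding has_weak_grad_def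
proof (intro allI impI)
  fix \<phi> k l assume \<phi>: "test_function \<Omega> \<phi>"
  let ?G = "piecewise_grad \<T> v"
  obtain K where K: "compact K" "K \<subseteq> \<Omega>" "\<And>x. x \<notin> K \<Longrightarrow> \<phi> x = 0"
      "\<And>x k. x \<notin> K \<Longrightarrow> partial_deriv k \<phi> x = 0"
    using test_function_support[OF \<phi>] by metis
  obtain B where B: "B \<ge> 0" "\<And>x. norm (\<phi> x) \<le> B"
    using bounded_of_compact_support[OF test_function_continuous[OF \<phi>] K(1,3)] by metis
  obtain N where N: "N \<ge> 0" "\<And>x. norm (v x) \<le> N" using bounded_affine_fe[OF v] by metis
  obtain M c where M: "\<And>T x. T \<in> \<T> \<Longrightarrow> x \<in> T \<Longrightarrow> v x = M T *v x + c T"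
    using affine_fe_coeffs[OF v] by metis
  obtain \<delta> C where \<delta>: "\<delta> > 0" and lip: "\<And>x t. \<bar>t\<bar> < \<delta> \<Longrightarrow>
       \<bar>v (x + t *\<^sub>R axis k 1) $ l * \<phi> (x + t *\<^sub>R axis k 1) - v x $ l * \<phi> x\<bar> \<le> C * \<bar>t\<bar>"
    using affine_fe_product_lipschitz[OF v \<phi>] by metis
  define F' where "F' x = v x $ l * partial_deriv k \<phi> x + ?G x $ k $ l * \<phi> x" for x
  have cont: "continuous_on \<Omega> v"
    using v closure_subset by (auto simp: affine_fe_def intro: continuous_on_subset)
  have meas: "(\<lambda>x. v x $ l * \<psi> x) \<in> borel_measurable borel"
    if "continuous_on UNIV \<psi>" "\<And>x. x \<notin> K \<Longrightarrow> \<psi> x = 0" for \<psi>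
  proof -
    have "(\<lambda>x. indicator \<Omega> x *\<^sub>R (v x $ l * \<psi> x)) \<in> borel_measurable borel"
      using that(1) cont open_\<Omega>
      by (intro borel_measurable_continuous_on_indicator continuous_intros) (auto intro: continuous_on_subset)
    also have "(\<lambda>x. indicator \<Omega> x *\<^sub>R (v x $ l * \<psi> x)) = (\<lambda>x. v x $ l * \<psi> x)"
      using that(2) K(2) by (auto simp: fun_eq_iff indicator_def)
    finally show ?thesis .
  qed
  have \<phi>m: "\<phi> \<in> borel_measurable borel"
    using test_function_continuous[OF \<phi>] by (rule borel_measurable_continuous_onI)
  have Gm: "(\<lambda>x. ?G x $ k $ l) \<in> borel_measurable borel"
    using measurable_compose[OF piecewise_grad_measurable[OF v]
        borel_measurable_continuous_onI[of "\<lambda>A. A $ k $ l"]]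
    by (simp add: continuous_intros)
  have F'm: "F' \<in> borel_measurable borel"
    unfolding F'_def using meas[OF partial_deriv_continuous[OF \<phi>] K(4)] \<phi>m Gm by measurable
  have "(LINT x|lborel. F' x) = 0"
  proof (rule integral_directional_derivative_eq_0[where F = "\<lambda>x. v x $ l * \<phi> x" and B = "N * B", OF _ F'm K(1) _ _ \<delta> lip])
    show "(\<lambda>x. v x $ l * \<phi> x) \<in> borel_measurable borel"
      by (rule meas[OF test_function_continuous[OF \<phi>] K(3)])
    show "\<bar>v x $ l * \<phi> x\<bar> \<le> N * B" for x
      using component_le_norm_cart[of "v x" l] N(2)[of x] B(2)[of x]
      by (auto simp: abs_mult N(1) intro!: mult_mono)
    show "AE x in lborel. ((\<lambda>t. v (x + t *\<^sub>R axis k 1) $ l * \<phi> (x + t *\<^sub>R axis k 1)) has_real_derivative F' x) (at 0)"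
      using AE_interior_cells
    proof eventually_elim
      case (elim x)
      show ?case
      proof (cases "x \<in> K")
        case False
        have F'0: "F' x = 0" using False K by (simp add: F'_def)
        have "open (- K)" using K(1) compact_imp_closed by auto
        then obtain e where e: "e > 0" "ball x e \<subseteq> - K" using False open_contains_ball by blast
        have "((\<lambda>t. 0) has_real_derivative 0) (at (0::real))" by simp
        then have "((\<lambda>t. v (x + t *\<^sub>R axis k 1) $ l * \<phi> (x + t *\<^sub>R axis k 1)) has_real_derivative 0) (at 0)"
        proof (rule has_field_derivative_transform_within_open[where S = "ball 0 e"])
          fix t :: real assume "t \<in> ball 0 e"
          then have "x + t *\<^sub>R axis k 1 \<in> ball x e" by (simp add: dist_norm)
          then show "0 = v (x + t *\<^sub>R axis k 1) $ l * \<phi> (x + t *\<^sub>R axis k 1)" using e(2) K(3) by auto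
        qed (use e in auto)
        then show ?thesis by (simp add: F'0)
      next
        case True
        then obtain T where T: "T \<in> \<T>" "x \<in> interior T" using elim K(2) by blast
        have G: "?G x = transpose (M T)" using piecewise_grad_interior[OF M T(2) T(1)] T(1) by blast
        have "(v has_derivative (\<lambda>h. M T *v h)) (at (x + 0 *\<^sub>R axis k 1))"
          using affine_on_has_derivative[OF M T(2)] T(1) by simp
        then have "((\<lambda>t. v (x + t *\<^sub>R axis k 1)) has_derivative (\<lambda>h. M T *v (h *\<^sub>R axis k 1))) (at 0)"
          by (rule has_derivative_compose[where f = "\<lambda>t. x + t *\<^sub>R axis k 1", rotated])
            (auto intro!: derivative_eq_intros)
        then have "((\<lambda>t. v (x + t *\<^sub>R axis k 1) $ l) has_derivative (\<lambda>h. (M T *v (h *\<^sub>R axis k 1)) $ l)) (at 0)"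
          by (rule bounded_linear.has_derivative[OF bounded_linear_vec_nth])
        moreover have "(M T *v (h *\<^sub>R axis k 1)) $ l = ?G x $ k $ l * h" for h
          by (simp add: G matrix_vector_mult_scaleR matrix_vector_mult_basis column_def transpose_def)
        ultimately have "((\<lambda>t. v (x + t *\<^sub>R axis k 1) $ l) has_real_derivative ?G x $ k $ l) (at 0)"
          by (simp add: has_field_derivative_def)
        from DERIV_mult[OF this partial_deriv_DERIV[OF \<phi>, where s = 0]]
        show ?thesis by (simp add: F'_def algebra_simps)
      qed
    qed
  qed (use K(3) in auto)
  also have "(LINT x|lborel. F' x) = (LINT x|lebesgue. F' x)"
    using F'm by (simp add: integral_completion)
  also have "\<dots> = (LINT x|lebesgue_on \<Omega>. F' x)"
  proof -
    have "F' x = 0" if "x \<notin> \<Omega>" for x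
    proof -
      have "x \<notin> K" using that K(2) by blast
      then show ?thesis by (simp add: F'_def K)
    qed
    then have "indicator \<Omega> x * F' x = F' x" for x by (auto simp: indicator_def)
    then show ?thesis
      by (simp only: lebesgue_on_integral_indicator[OF fmeasurableD[OF lmeasurable_\<Omega>]])
  qed
  also have "\<dots> = (LINT x|lebesgue_on \<Omega>. v x $ l * partial_deriv k \<phi> x) + (LINT x|lebesgue_on \<Omega>. ?G x $ k $ l * \<phi> x)"
    unfolding F'_def
    by (intro Bochner_Integration.integral_add integrable_L2_mult L2_vec_nth affine_fe_L2[OF v]
        piecewise_grad_L2[OF v] test_function_L2[OF lmeasurable_\<Omega> \<phi>])
  finally show "(LINT x|lebesgue_on \<Omega>. v x $ l * partial_deriv k \<phi> x) = - (LINT x|lebesgue_on \<Omega>. ?G x $ k $ l * \<phi> x)"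
    by simp
qed

lemma affine_fe_H1: "v \<in> affine_fe \<Omega> \<T> \<Longrightarrow> v \<in> H1 \<Omega>"
  using H1_I affine_fe_L2 piecewise_grad_L2 has_weak_grad_affine_fe by blast

text \<open>
  A vanishing weak gradient forces the linear part of \<open>v\<close> on each cell to be zero, since the interior
  of the cell meets \<open>\<Omega>\<close> in a nonempty open set, which is not null. So \<open>v\<close> takes finitely many values on
  a connected set, on which it is continuous.
\<close>

lemma affine_fe_constant:
  assumes v: "v \<in> affine_fe \<Omega> \<T>" and "connected \<Omega>"
    and int: "\<And>T. T \<in> \<T> \<Longrightarrow> interior T \<noteq> {}"
    and zero: "AE x in lebesgue_on \<Omega>. weak_grad \<Omega> v x = 0"
  shows "v constant_on closure \<Omega>"
proof -
  obtain M c where M: "\<And>T x. T \<in> \<T> \<Longrightarrow> x \<in> T \<Longrightarrow> v x = M T *v x + c T"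
    using affine_fe_coeffs[OF v] by metis
  have "AE x in lebesgue_on \<Omega>. piecewise_grad \<T> v x = 0"
    using zero weak_grad_AE_eq[OF affine_fe_L2[OF v] piecewise_grad_L2[OF v] has_weak_grad_affine_fe[OF v]]
    by eventually_elim simp
  then have AE: "AE x in lebesgue. x \<in> \<Omega> \<longrightarrow> piecewise_grad \<T> v x = 0"
    using lmeasurable_\<Omega> by (simp add: AE_restrict_space_iff fmeasurableD)
  have M0: "M T = 0" if T: "T \<in> \<T>" for T
  proof (rule ccontr)
    assume "M T \<noteq> 0"
    have "interior T \<inter> \<Omega> \<noteq> {}"
    proof -
      have "interior T \<subseteq> closure \<Omega>" using T Union_\<T> interior_subset by blast
      then show ?thesis
        using int[OF T] open_Int_closure_eq_empty[of "interior T" \<Omega>] by blast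
    qed
    moreover have "negligible (interior T \<inter> \<Omega>)"
    proof -
      have "AE x in lebesgue. x \<notin> interior T \<inter> \<Omega>"
        using AE
      proof eventually_elim
        case (elim x)
        show ?case
        proof
          assume x: "x \<in> interior T \<inter> \<Omega>"
          then have "transpose (M T) = 0"
            using elim piecewise_grad_interior[OF M[OF T] _ T, of x] by simp
          then have "M T = 0" by (simp add: transpose_def vec_eq_iff)
          then show False using \<open>M T \<noteq> 0\<close> by simp
        qed
      qed
      moreover have "interior T \<inter> \<Omega> \<in> sets lebesgue" using open_\<Omega> by auto
      ultimately show ?thesis
        by (simp add: negligible_iff_null_sets AE_iff_null_sets)
    qed
    ultimately show False using open_not_negligible[of "interior T \<inter> \<Omega>"] open_\<Omega> by auto
  qed
  have "v ` closure \<Omega> \<subseteq> c ` \<T>"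
  proof clarify
    fix x assume "x \<in> closure \<Omega>"
    then obtain T where "T \<in> \<T>" "x \<in> T" using Union_\<T> by blast
    then show "v x \<in> c ` \<T>" using M[of T x] M0[of T] by simp
  qed
  then have "finite (v ` closure \<Omega>)" using finite_\<T> finite_surj by blast
  moreover have "connected (closure \<Omega>)" using \<open>connected \<Omega>\<close> by (rule connected_imp_connected_closure)
  moreover have "continuous_on (closure \<Omega>) v" using v by (simp add: affine_fe_def)
  ultimately have "v ` closure \<Omega> = {} \<or> (\<exists>c. v ` closure \<Omega> = {c})"
    using connected_finite_iff_sing[OF connected_continuous_image] by blast
  then show ?thesis
  proof
    assume "\<exists>c. v ` closure \<Omega> = {c}"
    then obtain c where "v ` closure \<Omega> = {c}" ..
    then have "\<forall>x\<in>closure \<Omega>. v x = c" by (metis image_eqI singletonD)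
    then show ?thesis unfolding constant_on_def ..
  qed (simp add: constant_on_def)
qed

end

section \<open>The elastic bilinear form\<close>

text \<open>
  Writing the strain through a linear map of matrices lets it inherit linearity and square
  integrability from the weak gradient.
\<close>

definition symmetric_part :: "real^'n^'n \<Rightarrow> real^'n^'n" where
  "symmetric_part B = (1/2) *\<^sub>R (B + transpose B)"

lemma transpose_add: "transpose (A + B) = transpose A + transpose (B :: real^'n^'m)"
  by (simp add: transpose_def vec_eq_iff)

lemma transpose_scaleR: "transpose (c *\<^sub>R B) = c *\<^sub>R transpose (B :: real^'n^'m)"
  by (simp add: transpose_def vec_eq_iff)

lemma symmetric_part_add: "symmetric_part (A + B) = symmetric_part A + symmetric_part B"
  by (simp add: symmetric_part_def transpose_add algebra_simps)

lemma symmetric_part_scaleR: "symmetric_part (c *\<^sub>R B) = c *\<^sub>R symmetric_part B"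
  by (simp add: symmetric_part_def transpose_scaleR algebra_simps)

lemma bounded_linear_symmetric_part: "bounded_linear symmetric_part"
  by (intro linear_conv_bounded_linear[THEN iffD1] linearI symmetric_part_add symmetric_part_scaleR)

lemma transpose_symmetric_part: "transpose (symmetric_part B) = symmetric_part B"
  by (simp add: symmetric_part_def transpose_scaleR transpose_add add.commute)

lemma strain_eq: "strain \<Omega> v x = symmetric_part (weak_grad \<Omega> v x)"
  by (simp add: strain_def symmetric_part_def)

lemma tensor_apply_add: "tensor_apply a (S + T) = tensor_apply a S + tensor_apply a T"
  by (simp add: tensor_apply_def vec_eq_iff sum.distrib distrib_left)

lemma tensor_apply_scaleR: "tensor_apply a (c *\<^sub>R S) = c *\<^sub>R tensor_apply a S"
  by (simp add: tensor_apply_def vec_eq_iff sum_distrib_left mult.left_commute)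

lemma tensor_apply_inner:
  "tensor_apply a S \<bullet> T = (\<Sum>i\<in>UNIV. \<Sum>j\<in>UNIV. \<Sum>k\<in>UNIV. \<Sum>l\<in>UNIV. a i j k l * (S $ k $ l * T $ i $ j))"
  by (simp add: tensor_apply_def inner_vec_def sum_distrib_right mult.assoc)

text \<open>
  The major symmetry of the tensor exchanges the index pairs of the two arguments.
\<close>

lemma tensor_apply_inner_commute:
  fixes a :: "('n::finite) tensor4"
  assumes "\<And>i j k l. a i j k l = a k l i j"
  shows "tensor_apply a S \<bullet> T = tensor_apply a T \<bullet> S"
proof -
  have pair: "(\<Sum>i\<in>UNIV. \<Sum>j\<in>UNIV. g i j) = (\<Sum>p\<in>UNIV. g (fst p) (snd p))"
    for g :: "'n \<Rightarrow> 'n \<Rightarrow> real"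
    by (simp add: sum.cartesian_product split_def)
  have "tensor_apply a S \<bullet> T =
      (\<Sum>p\<in>UNIV. \<Sum>q\<in>UNIV. a (fst p) (snd p) (fst q) (snd q) * (S $ fst q $ snd q * T $ fst p $ snd p))"
    unfolding tensor_apply_inner pair ..
  also have "\<dots> = (\<Sum>q\<in>UNIV. \<Sum>p\<in>UNIV. a (fst p) (snd p) (fst q) (snd q) * (S $ fst q $ snd q * T $ fst p $ snd p))"
    by (rule sum.swap)
  also have "\<dots> = (\<Sum>q\<in>UNIV. \<Sum>p\<in>UNIV. a (fst q) (snd q) (fst p) (snd p) * (T $ fst p $ snd p * S $ fst q $ snd q))"
    by (subst assms) (simp only: mult.commute)
  also have "\<dots> = tensor_apply a T \<bullet> S"
    unfolding tensor_apply_inner pair ..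
  finally show ?thesis .
qed

lemma integrable_AE_bounded_mult:
  fixes a g :: "'a \<Rightarrow> real"
  assumes "a \<in> borel_measurable M" "AE x in M. \<bar>a x\<bar> \<le> B" "integrable M g"
  shows "integrable M (\<lambda>x. a x * g x)"
proof (rule Bochner_Integration.integrable_bound)
  show "integrable M (\<lambda>x. B * \<bar>g x\<bar>)" using assms(3) by simp
  show "AE x in M. norm (a x * g x) \<le> norm (B * \<bar>g x\<bar>)"
    using assms(2)
  proof eventually_elim
    case (elim x)
    then have "\<bar>a x\<bar> \<le> \<bar>B\<bar>" by linarith
    then show ?case by (simp add: abs_mult mult_right_mono)
  qed
qed (use assms in auto)

text \<open>
  Elements of \<open>V\<close> are functions rather than equivalence classes, and \<open>B\<close> is constrained on \<open>V\<close> only.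
  Stated in this form, the error analysis of the ideal method is pure linear algebra.
\<close>

locale symmetric_bilinear_form =
  fixes V :: "('a \<Rightarrow> 'b::real_vector) set" and B :: "('a \<Rightarrow> 'b) \<Rightarrow> ('a \<Rightarrow> 'b) \<Rightarrow> real"
  assumes V_add: "v \<in> V \<Longrightarrow> w \<in> V \<Longrightarrow> (\<lambda>x. v x + w x) \<in> V"
    and V_scaleR: "v \<in> V \<Longrightarrow> (\<lambda>x. c *\<^sub>R v x) \<in> V"
    and add_left: "v \<in> V \<Longrightarrow> v' \<in> V \<Longrightarrow> w \<in> V \<Longrightarrow> B (\<lambda>x. v x + v' x) w = B v w + B v' w"
    and scaleR_left: "v \<in> V \<Longrightarrow> w \<in> V \<Longrightarrow> B (\<lambda>x. c *\<^sub>R v x) w = c * B v w"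
    and commute: "v \<in> V \<Longrightarrow> w \<in> V \<Longrightarrow> B v w = B w v"
begin

lemma V_diff: "v \<in> V \<Longrightarrow> w \<in> V \<Longrightarrow> (\<lambda>x. v x - w x) \<in> V"
  using V_add[of v "\<lambda>x. (-1) *\<^sub>R w x"] V_scaleR[of w "-1"] by simp

lemma diff_left: "v \<in> V \<Longrightarrow> v' \<in> V \<Longrightarrow> w \<in> V \<Longrightarrow> B (\<lambda>x. v x - v' x) w = B v w - B v' w"
  using add_left[of v "\<lambda>x. (-1) *\<^sub>R v' x" w] V_scaleR[of v' "-1"] scaleR_left[of v' w "-1"] by simp

end

locale elasticity = bounded_open_set \<Omega> for \<Omega> :: "(real^'n) set" +
  fixes A :: "real^'n \<Rightarrow> 'n tensor4" and \<alpha> \<beta> :: real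
  assumes tensor: "elasticity_tensor \<Omega> A \<alpha> \<beta>"
begin

lemma strain_L2: "v \<in> H1 \<Omega> \<Longrightarrow> L2 (lebesgue_on \<Omega>) (strain \<Omega> v)"
  using L2_bounded_linear[OF weak_grad(1) bounded_linear_symmetric_part] by (simp add: strain_eq[abs_def])

lemma strain_add:
  assumes "v \<in> H1 \<Omega>" "w \<in> H1 \<Omega>"
  shows "AE x in lebesgue_on \<Omega>. strain \<Omega> (\<lambda>x. v x + w x) x = strain \<Omega> v x + strain \<Omega> w x"
  using H1_add(2)[OF assms] by eventually_elim (simp add: strain_eq symmetric_part_add)

lemma strain_scaleR:
  assumes "v \<in> H1 \<Omega>"
  shows "AE x in lebesgue_on \<Omega>. strain \<Omega> (\<lambda>x. c *\<^sub>R v x) x = c *\<^sub>R strain \<Omega> v x"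
  using H1_scaleR(2)[OF assms, of c] by eventually_elim (simp add: strain_eq symmetric_part_scaleR)

lemma integrable_energy:
  assumes "L2 (lebesgue_on \<Omega>) S" "L2 (lebesgue_on \<Omega>) T"
  shows "integrable (lebesgue_on \<Omega>) (\<lambda>x. tensor_apply (A x) (S x) \<bullet> T x)"
proof -
  have "integrable (lebesgue_on \<Omega>) (\<lambda>x. A x i j k l * (S x $ k $ l * T x $ i $ j))" for i j k l
  proof -
    obtain M where "AE x in lebesgue_on \<Omega>. \<bar>A x i j k l\<bar> \<le> M"
      using tensor unfolding elasticity_tensor_def by blast
    moreover have "(\<lambda>x. A x i j k l) \<in> borel_measurable (lebesgue_on \<Omega>)"
      using tensor unfolding elasticity_tensor_def by blast
    ultimately show ?thesis
      by (intro integrable_AE_bounded_mult integrable_L2_mult L2_vec_nth assms)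
  qed
  then show ?thesis unfolding tensor_apply_inner by (intro Bochner_Integration.integrable_sum)
qed

text \<open>
  The strain of a combination of functions is known only almost everywhere; this lemma replaces it by
  an explicit representative under the integral.
\<close>

lemma elastic_form_cong:
  assumes "L2 (lebesgue_on \<Omega>) S" "AE x in lebesgue_on \<Omega>. strain \<Omega> v x = S x" "v \<in> H1 \<Omega>" "w \<in> H1 \<Omega>"
  shows "elastic_form \<Omega> A v w = (LINT x|lebesgue_on \<Omega>. tensor_apply (A x) (S x) \<bullet> strain \<Omega> w x)"
  unfolding elastic_form_def
proof (rule integral_cong_AE)
  show "AE x in lebesgue_on \<Omega>. tensor_apply (A x) (strain \<Omega> v x) \<bullet> strain \<Omega> w x =
      tensor_apply (A x) (S x) \<bullet> strain \<Omega> w x"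
    using assms(2) by eventually_elim simp
qed (use assms strain_L2 integrable_energy in blast)+

sublocale form: symmetric_bilinear_form "H1 \<Omega>" "elastic_form \<Omega> A"
proof
  fix v w :: "real^'n \<Rightarrow> real^'n" assume v: "v \<in> H1 \<Omega>" and w: "w \<in> H1 \<Omega>"
  show "(\<lambda>x. v x + w x) \<in> H1 \<Omega>" by (rule H1_add(1)[OF v w])
  show "elastic_form \<Omega> A (\<lambda>x. c *\<^sub>R v x) w = c * elastic_form \<Omega> A v w" for c
    using integrable_energy[OF strain_L2[OF v] strain_L2[OF w]]
      elastic_form_cong[OF L2_scaleR[OF strain_L2[OF v]] strain_scaleR[OF v] H1_scaleR(1)[OF v] w]
    by (simp add: tensor_apply_scaleR elastic_form_def)
  have "AE x in lebesgue_on \<Omega>. \<forall>i j k l. A x i j k l = A x k l i j"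
    using tensor unfolding elasticity_tensor_def by (auto elim: AE_mp)
  then have "AE x in lebesgue_on \<Omega>. tensor_apply (A x) (strain \<Omega> v x) \<bullet> strain \<Omega> w x =
      tensor_apply (A x) (strain \<Omega> w x) \<bullet> strain \<Omega> v x"
    by eventually_elim (rule tensor_apply_inner_commute, blast)
  then show "elastic_form \<Omega> A v w = elastic_form \<Omega> A w v"
    unfolding elastic_form_def
    using integrable_energy[OF strain_L2[OF v] strain_L2[OF w]]
      integrable_energy[OF strain_L2[OF w] strain_L2[OF v]]
    by (intro integral_cong_AE) auto
  fix v' :: "real^'n \<Rightarrow> real^'n" assume v': "v' \<in> H1 \<Omega>"
  show "elastic_form \<Omega> A (\<lambda>x. v x + v' x) w = elastic_form \<Omega> A v w + elastic_form \<Omega> A v' w"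
    using integrable_energy[OF strain_L2[OF v] strain_L2[OF w]]
      integrable_energy[OF strain_L2[OF v'] strain_L2[OF w]]
      elastic_form_cong[OF L2_add[OF strain_L2[OF v] strain_L2[OF v']] strain_add[OF v v'] H1_add(1)[OF v v'] w]
    by (simp add: tensor_apply_add inner_add_left elastic_form_def)
qed (rule H1_scaleR(1))

lemma \<alpha>_pos: "0 < \<alpha>"
  using tensor by (simp add: elasticity_tensor_def)

lemma elastic_form_coercive:
  assumes v: "v \<in> H1 \<Omega>"
  shows "\<alpha> * (l2_norm (lebesgue_on \<Omega>) (strain \<Omega> v))\<^sup>2 \<le> elastic_form \<Omega> A v v"
proof -
  have "AE x in lebesgue_on \<Omega>. \<forall>B. transpose B = B \<longrightarrow>
        \<alpha> * (B \<bullet> B) \<le> tensor_apply (A x) B \<bullet> B \<and> tensor_apply (A x) B \<bullet> B \<le> \<beta> * (B \<bullet> B)"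
    using tensor by (simp add: elasticity_tensor_def)
  then have AE: "AE x in lebesgue_on \<Omega>. \<alpha> * (norm (strain \<Omega> v x))\<^sup>2 \<le> tensor_apply (A x) (strain \<Omega> v x) \<bullet> strain \<Omega> v x"
    by eventually_elim (simp add: strain_eq transpose_symmetric_part power2_norm_eq_inner)
  have "\<alpha> * (l2_norm (lebesgue_on \<Omega>) (strain \<Omega> v))\<^sup>2 = (LINT x|lebesgue_on \<Omega>. \<alpha> * (norm (strain \<Omega> v x))\<^sup>2)"
    by (simp add: l2_norm_sq)
  also have "\<dots> \<le> elastic_form \<Omega> A v v"
    unfolding elastic_form_def using AE strain_L2[OF v]
    by (intro integral_mono_AE integrable_energy strain_L2[OF v]) (auto simp: L2_def)
  finally show ?thesis .
qed

end

section \<open>Finite element spaces\<close>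

definition function_subspace :: "('a \<Rightarrow> 'b::real_vector) set \<Rightarrow> bool" where
  "function_subspace V \<longleftrightarrow>
     (\<forall>v\<in>V. \<forall>w\<in>V. (\<lambda>x. v x + w x) \<in> V) \<and> (\<forall>v\<in>V. \<forall>c. (\<lambda>x. c *\<^sub>R v x) \<in> V)"

lemma function_subspace_add: "function_subspace V \<Longrightarrow> v \<in> V \<Longrightarrow> w \<in> V \<Longrightarrow> (\<lambda>x. v x + w x) \<in> V"
  by (simp add: function_subspace_def)

lemma function_subspace_scaleR: "function_subspace V \<Longrightarrow> v \<in> V \<Longrightarrow> (\<lambda>x. c *\<^sub>R v x) \<in> V"
  by (simp add: function_subspace_def)

lemma function_subspace_diff:
  assumes "function_subspace V" "v \<in> V" "w \<in> V"
  shows "(\<lambda>x. v x - w x) \<in> V"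
  using function_subspace_add[OF assms(1,2) function_subspace_scaleR[OF assms(1,3), of "-1"]] by simp

lemma function_subspace_Int: "function_subspace V \<Longrightarrow> function_subspace W \<Longrightarrow> function_subspace (V \<inter> W)"
  by (simp add: function_subspace_def)

lemma function_subspace_affine_fe:
  fixes \<Omega> :: "(real^'n) set"
  shows "function_subspace (affine_fe \<Omega> \<T>)"
proof -
  have "(\<lambda>x. v x + w x) \<in> affine_fe \<Omega> \<T>" if v: "v \<in> affine_fe \<Omega> \<T>" and w: "w \<in> affine_fe \<Omega> \<T>" for v w
  proof -
    have "\<exists>(M :: real^'n^'n) c. \<forall>x\<in>T. v x + w x = M *v x + c" if T: "T \<in> \<T>" for T
    proof -
      have "\<exists>(M :: real^'n^'n) c. \<forall>x\<in>T. v x = M *v x + c" "\<exists>(M :: real^'n^'n) c. \<forall>x\<in>T. w x = M *v x + c"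
        using v w T by (simp_all add: affine_fe_def)
      then obtain M M' :: "real^'n^'n" and c c'
        where "\<forall>x\<in>T. v x = M *v x + c" "\<forall>x\<in>T. w x = M' *v x + c'" by blast
      then show ?thesis
        by (intro exI[of _ "M + M'"] exI[of _ "c + c'"]) (simp add: matrix_vector_mult_add_rdistrib)
    qed
    then show ?thesis using v w by (simp add: affine_fe_def continuous_on_add)
  qed
  moreover have "(\<lambda>x. c *\<^sub>R v x) \<in> affine_fe \<Omega> \<T>" if v: "v \<in> affine_fe \<Omega> \<T>" for v c
  proof -
    have "\<exists>(M :: real^'n^'n) c'. \<forall>x\<in>T. c *\<^sub>R v x = M *v x + c'" if T: "T \<in> \<T>" for T
    proof -
      have "\<exists>(M :: real^'n^'n) c. \<forall>x\<in>T. v x = M *v x + c" using v T by (simp add: affine_fe_def)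
      then obtain M :: "real^'n^'n" and c' where "\<forall>x\<in>T. v x = M *v x + c'" by blast
      then show ?thesis
        by (intro exI[of _ "c *\<^sub>R M"] exI[of _ "c *\<^sub>R c'"]) (simp add: scaleR_matrix_vector_assoc scaleR_right_distrib)
    qed
    then show ?thesis using v by (simp add: affine_fe_def continuous_on_scaleR)
  qed
  ultimately show ?thesis by (simp add: function_subspace_def)
qed

lemma affine_fe_refinement:
  fixes \<Omega> :: "(real^'n) set"
  assumes "refines_mesh \<T>h \<T>H"
  shows "affine_fe \<Omega> \<T>H \<subseteq> affine_fe \<Omega> \<T>h"
proof
  fix v assume v: "v \<in> affine_fe \<Omega> \<T>H"
  have "\<exists>(M :: real^'n^'n) c. \<forall>x\<in>T. v x = M *v x + c" if T: "T \<in> \<T>h" for T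
  proof -
    obtain T' where T': "T' \<in> \<T>H" "T \<subseteq> T'" using assms T unfolding refines_mesh_def by blast
    have "\<exists>(M :: real^'n^'n) c. \<forall>x\<in>T'. v x = M *v x + c" using v T'(1) by (simp add: affine_fe_def)
    then obtain M :: "real^'n^'n" and c where "\<forall>x\<in>T'. v x = M *v x + c" by blast
    then have "\<forall>x\<in>T. v x = M *v x + c" using T'(2) by blast
    then show ?thesis by blast
  qed
  then show "v \<in> affine_fe \<Omega> \<T>h" using v by (simp add: affine_fe_def)
qed

lemma (in bounded_open_set) function_subspace_H1_zero:
  assumes "trace_operator \<Omega> \<Gamma> \<gamma>"
  shows "function_subspace (H1_zero \<Omega> \<Gamma> \<gamma>)"
proof -
  have "(\<lambda>x. v x + w x) \<in> H1_zero \<Omega> \<Gamma> \<gamma>" if "v \<in> H1_zero \<Omega> \<Gamma> \<gamma>" "w \<in> H1_zero \<Omega> \<Gamma> \<gamma>" for v w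
  proof -
    have v: "v \<in> H1 \<Omega>" "AE x in surface_on \<Gamma>. \<gamma> v x = 0"
      and w: "w \<in> H1 \<Omega>" "AE x in surface_on \<Gamma>. \<gamma> w x = 0" using that by (auto simp: H1_zero_def)
    have "AE x in surface_on \<Gamma>. \<gamma> (\<lambda>y. v y + w y) x = \<gamma> v x + \<gamma> w x"
      using assms v(1) w(1) by (simp add: trace_operator_def)
    with v(2) w(2) have "AE x in surface_on \<Gamma>. \<gamma> (\<lambda>y. v y + w y) x = 0" by eventually_elim simp
    then show ?thesis using H1_add(1)[OF v(1) w(1)] by (simp add: H1_zero_def)
  qed
  moreover have "(\<lambda>x. c *\<^sub>R v x) \<in> H1_zero \<Omega> \<Gamma> \<gamma>" if "v \<in> H1_zero \<Omega> \<Gamma> \<gamma>" for v c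
  proof -
    have v: "v \<in> H1 \<Omega>" "AE x in surface_on \<Gamma>. \<gamma> v x = 0" using that by (auto simp: H1_zero_def)
    have "AE x in surface_on \<Gamma>. \<gamma> (\<lambda>y. c *\<^sub>R v y) x = c *\<^sub>R \<gamma> v x"
      using assms v(1) by (simp add: trace_operator_def)
    with v(2) have "AE x in surface_on \<Gamma>. \<gamma> (\<lambda>y. c *\<^sub>R v y) x = 0" by eventually_elim simp
    then show ?thesis using H1_scaleR(1)[OF v(1)] by (simp add: H1_zero_def)
  qed
  ultimately show ?thesis by (simp add: function_subspace_def)
qed

lemma simplex_interior_nonempty:
  fixes T :: "(real^'n) set"
  assumes "int CARD('n) simplex T"
  shows "interior T \<noteq> {}"
proof -
  have dim: "aff_dim T = int DIM(real^'n)" using aff_dim_simplex[OF assms] by simp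
  have "convex T" using assms by (auto simp: simplex_def)
  moreover have "T \<noteq> {}" using dim by auto
  ultimately have "rel_interior T \<noteq> {}" by (simp add: rel_interior_eq_empty)
  moreover have "affine hull T = UNIV" using dim aff_dim_eq_full by blast
  ultimately show ?thesis by (simp add: rel_interior_interior)
qed

lemma (in bounded_open_set) mesh_triangulated_domain:
  assumes "mesh \<Omega> \<T>"
  shows "triangulated_domain \<Omega> \<T>"
proof
  show "finite \<T>" "\<Union>\<T> = closure \<Omega>" using assms by (auto simp: mesh_def triangulation_def)
  fix T assume "T \<in> \<T>"
  then have "int CARD('n) simplex T" using assms by (simp add: mesh_def)
  then show "closed T" "convex T"
    by (rule closed_simplex, rule convex_simplex)
qed

lemma mesh_size_bounds:
  assumes "mesh \<Omega> \<T>" "\<Omega> \<noteq> {}" "bounded \<Omega>"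
  shows "0 \<le> mesh_size \<T>" "mesh_size \<T> \<le> diameter (closure \<Omega>)"
proof -
  have T: "finite \<T>" "\<Union>\<T> = closure \<Omega>" using assms(1) by (auto simp: mesh_def triangulation_def)
  have "\<T> \<noteq> {}"
  proof
    assume "\<T> = {}"
    then have "closure \<Omega> = {}" using T(2) by simp
    then show False using assms(2) by simp
  qed
  then obtain T0 where T0: "T0 \<in> \<T>" by blast
  have bd: "bounded (closure \<Omega>)" using assms(3) by (rule bounded_closure)
  have b: "bounded T" "diameter T \<le> diameter (closure \<Omega>)" if "T \<in> \<T>" for T
  proof -
    have "T \<subseteq> closure \<Omega>" using T(2) that by blast
    then show "bounded T" "diameter T \<le> diameter (closure \<Omega>)"
      using bd by (auto intro: bounded_subset diameter_subset)
  qed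
  show "mesh_size \<T> \<le> diameter (closure \<Omega>)"
    unfolding mesh_size_def using T(1) \<open>\<T> \<noteq> {}\<close> b(2) by (intro Max.boundedI) auto
  have "0 \<le> diameter T0" by (rule diameter_ge_0[OF b(1)[OF T0]])
  also have "\<dots> \<le> mesh_size \<T>" unfolding mesh_size_def using T(1) T0 by (intro Max_ge) auto
  finally show "0 \<le> mesh_size \<T>" .
qed

lemma linear_between_diff:
  assumes "linear_between V W J" "function_subspace V" "v \<in> V" "w \<in> V"
  shows "J (\<lambda>x. v x - w x) = (\<lambda>x. J v x - J w x)"
proof -
  have w: "(\<lambda>x. (-1) *\<^sub>R w x) \<in> V" by (rule function_subspace_scaleR[OF assms(2,4)])
  have "J (\<lambda>x. (-1) *\<^sub>R w x) = (\<lambda>x. (-1) *\<^sub>R J w x)"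
    using assms(1,4) unfolding linear_between_def by blast
  moreover have "\<And>v w. v \<in> V \<Longrightarrow> w \<in> V \<Longrightarrow> J (\<lambda>x. v x + w x) = (\<lambda>x. J v x + J w x)"
    using assms(1) by (simp add: linear_between_def)
  from this[OF assms(3) w]
  have "J (\<lambda>x. v x + (-1) *\<^sub>R w x) = (\<lambda>x. J v x + J (\<lambda>x. (-1) *\<^sub>R w x) x)" .
  ultimately show ?thesis by simp
qed

section \<open>The error of the ideal method\<close>

text \<open>
  Here \<open>F\<close> is the volume load and \<open>N\<close> the Neumann load. Testing with multiscale functions, the error
  \<open>e\<close> is Galerkin orthogonal to the multiscale space; testing with fine functions, the definition of
  \<open>bf\<close> removes the Neumann load, the corrector \<open>R gh\<close> removes the boundary data, and the multiscale
  part \<open>um\<close> drops out by orthogonality, so that only \<open>F\<close> is left. The splitting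
  \<open>e = (e - em) + em\<close> with \<open>em = J e - R (J e)\<close> realises the decomposition of the discrete space into
  the fine and the multiscale space, which are \<open>B\<close>-orthogonal; hence \<open>B em em = B e em = 0\<close>.
\<close>

lemma ideal_error_decomposition:
  fixes Vh VH Sh :: "(real^'n \<Rightarrow> real^'n) set"
  assumes "symmetric_bilinear_form V B" and "Sh \<subseteq> V" and "Vh \<subseteq> Sh" and "VH \<subseteq> Vh"
    and Vh: "function_subspace Vh"
    and J: "linear_between Vh VH J" "\<And>v. v \<in> Vh \<Longrightarrow> J (J v) = J v"
    and R: "\<And>v. v \<in> Sh \<Longrightarrow> R v \<in> fine_space Vh J"
      "\<And>v w. v \<in> Sh \<Longrightarrow> w \<in> fine_space Vh J \<Longrightarrow> B (R v) w = B v w"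
    and gh: "gh \<in> Sh"
    and u0: "u0 \<in> Vh" "\<And>v. v \<in> Vh \<Longrightarrow> B u0 v = F v + N v - B gh v"
    and bf: "bf \<in> fine_space Vh J" "\<And>w. w \<in> fine_space Vh J \<Longrightarrow> B bf w = N w"
    and um: "um \<in> multiscale_space VH R"
      "\<And>v. v \<in> multiscale_space VH R \<Longrightarrow> B um v = F v + N v - B (\<lambda>x. bf x + gh x - R gh x) v"
  defines "e \<equiv> \<lambda>x. u0 x - um x - bf x + R gh x"
  obtains ef em where "ef \<in> fine_space Vh J" "em \<in> Vh" "e = (\<lambda>x. ef x + em x)" "B em em = 0"
    "\<And>w. w \<in> fine_space Vh J \<Longrightarrow> B e w = F w"
proof -
  interpret symmetric_bilinear_form V B by fact
  have fine_Vh: "v \<in> Vh" "J v = (\<lambda>x. 0)" if "v \<in> fine_space Vh J" for v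
    using that by (auto simp: fine_space_def)
  have Vh_V: "v \<in> V" if "v \<in> Vh" for v using that assms(2,3) by blast
  have ms_Vh: "v \<in> Vh" if v: "v \<in> multiscale_space VH R" for v
  proof -
    from v obtain z where "z \<in> VH" "v = (\<lambda>x. z x - R z x)" by (auto simp: multiscale_space_def)
    then show ?thesis using R(1)[of z] fine_Vh(1) assms(3,4) function_subspace_diff[OF Vh] by blast
  qed
  have orth: "B v w = 0" if v: "v \<in> multiscale_space VH R" and w: "w \<in> fine_space Vh J" for v w
  proof -
    from v obtain z where z: "z \<in> VH" "v = (\<lambda>x. z x - R z x)" by (auto simp: multiscale_space_def)
    then have "z \<in> Sh" using assms(3,4) by blast
    moreover have "R z \<in> V" "z \<in> V" using \<open>z \<in> Sh\<close> R(1) fine_Vh(1) Vh_V assms(2) by blast+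
    ultimately show ?thesis using R(2)[OF _ w] Vh_V[OF fine_Vh(1)[OF w]] by (simp add: z(2) diff_left)
  qed
  have Rg: "R gh \<in> Vh" "R gh \<in> V" using R(1)[OF gh] fine_Vh(1) Vh_V by blast+
  have in_V: "u0 \<in> V" "um \<in> V" "bf \<in> V" "gh \<in> V"
    using u0(1) ms_Vh[OF um(1)] fine_Vh(1)[OF bf(1)] gh Vh_V assms(2) by blast+
  have e_Vh: "e \<in> Vh"
    unfolding e_def using u0(1) ms_Vh[OF um(1)] fine_Vh(1)[OF bf(1)] Rg(1)
    by (intro function_subspace_add[OF Vh] function_subspace_diff[OF Vh])
  have Be: "B e w = B u0 w - B um w - B bf w + B (R gh) w" if "w \<in> V" for w
    unfolding e_def using that in_V Rg(2) by (simp add: add_left diff_left V_diff)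
  have Bg: "B (\<lambda>x. bf x + gh x - R gh x) w = B bf w + B gh w - B (R gh) w" if "w \<in> V" for w
    using that in_V Rg(2) by (simp add: add_left diff_left V_add)
  have e_ms: "B e w = 0" if w: "w \<in> multiscale_space VH R" for w
    using Be Bg u0(2) um(2)[OF w] ms_Vh[OF w] Vh_V by simp
  have e_fine: "B e w = F w" if w: "w \<in> fine_space Vh J" for w
    using Be u0(2) bf(2)[OF w] R(2)[OF gh w] orth[OF um(1) w] fine_Vh(1)[OF w] Vh_V by simp
  have Je: "J e \<in> VH" using J(1) e_Vh by (auto simp: linear_between_def)
  define em where "em x = J e x - R (J e) x" for x
  have em_ms: "em \<in> multiscale_space VH R"
    unfolding em_def[abs_def] multiscale_space_def using Je by blast
  then have em_Vh: "em \<in> Vh" by (rule ms_Vh)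
  define ef where "ef x = e x - em x" for x
  have ef: "ef \<in> fine_space Vh J"
  proof -
    have RJ: "R (J e) \<in> fine_space Vh J" using R(1) Je assms(3,4) by blast
    have "J em = (\<lambda>x. J (J e) x - J (R (J e)) x)"
      unfolding em_def[abs_def] using Je assms(4) fine_Vh(1)[OF RJ]
      by (intro linear_between_diff[OF J(1) Vh]) auto
    then have "J em = J e" using J(2)[OF e_Vh] fine_Vh(2)[OF RJ] by simp
    moreover have "J ef = (\<lambda>x. J e x - J em x)"
      unfolding ef_def[abs_def] by (intro linear_between_diff[OF J(1) Vh] e_Vh em_Vh)
    moreover have "ef \<in> Vh"
      unfolding ef_def[abs_def] by (intro function_subspace_diff[OF Vh] e_Vh em_Vh)
    ultimately show ?thesis by (simp add: fine_space_def)
  qed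
  have split: "e = (\<lambda>x. ef x + em x)" by (simp add: ef_def)
  have "B e em = B ef em + B em em"
    unfolding split using Vh_V em_Vh fine_Vh(1)[OF ef] by (intro add_left) auto
  moreover have "B ef em = 0"
    using orth[OF em_ms ef] commute Vh_V em_Vh fine_Vh(1)[OF ef] by simp
  ultimately have "B em em = 0" using e_ms[OF em_ms] by simp
  then show ?thesis using that ef em_Vh split e_fine by blast
qed

text \<open>
  On a function that is continuous up to the boundary the trace is the restriction, so a constant with
  vanishing trace on a set of positive surface measure is zero.
\<close>

lemma (in triangulated_domain) affine_fe_H1_zero_eq_0:
  assumes v: "v \<in> affine_fe \<Omega> \<T>" "v \<in> H1_zero \<Omega> \<Gamma> \<gamma>" and const: "v constant_on closure \<Omega>"
    and trace: "trace_operator \<Omega> \<Gamma> \<gamma>"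
    and \<Gamma>: "\<Gamma> \<subseteq> closure \<Omega>" "\<Gamma> \<in> sets surface_measure" "emeasure surface_measure \<Gamma> > 0"
  shows "v = (\<lambda>x. 0)"
proof -
  obtain c where c: "\<And>x. x \<in> closure \<Omega> \<Longrightarrow> v x = c" using const by (auto simp: constant_on_def)
  have "v \<in> H1 \<Omega>" "AE x in surface_on \<Gamma>. \<gamma> v x = 0" using v(2) by (auto simp: H1_zero_def)
  moreover have "AE x in surface_on \<Gamma>. \<gamma> v x = v x"
    using trace \<open>v \<in> H1 \<Omega>\<close> v(1) by (auto simp: trace_operator_def affine_fe_def)
  ultimately have "AE x in surface_on \<Gamma>. v x = 0" by (auto elim: AE_mp)
  then have AE: "AE x in surface_measure. x \<in> \<Gamma> \<longrightarrow> v x = 0"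
    using \<Gamma>(2) by (simp add: AE_restrict_space_iff)
  have "c = 0"
  proof (rule ccontr)
    assume "c \<noteq> 0"
    from AE have "AE x in surface_measure. x \<notin> \<Gamma>"
      by eventually_elim (use \<open>c \<noteq> 0\<close> c \<Gamma>(1) in auto)
    then have "\<Gamma> \<in> null_sets surface_measure" by (rule AE_iff_null_sets[OF \<Gamma>(2), THEN iffD2])
    then show False using \<Gamma>(3) by auto
  qed
  then show ?thesis using c v(1) by (auto simp: affine_fe_def fun_eq_iff)
qed

lemma (in elasticity) weak_grad_AE_0_if_energy_0:
  assumes korn: "korn_constant \<Omega> V Cko" and v: "v \<in> V" "v \<in> H1 \<Omega>" and zero: "elastic_form \<Omega> A v v = 0"
  shows "AE x in lebesgue_on \<Omega>. weak_grad \<Omega> v x = 0"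
proof -
  have "\<alpha> * (l2_norm (lebesgue_on \<Omega>) (strain \<Omega> v))\<^sup>2 \<le> 0"
    using elastic_form_coercive[OF v(2)] zero by simp
  then have "l2_norm (lebesgue_on \<Omega>) (strain \<Omega> v) = 0"
    using \<alpha>_pos by (simp add: mult_le_0_iff)
  then have "l2_norm (lebesgue_on \<Omega>) (weak_grad \<Omega> v) \<le> 0"
    using korn v(1) by (force simp: korn_constant_def)
  then show ?thesis
    using l2_norm_eq_0_iff_AE[OF weak_grad(1)[OF v(2)]] l2_norm_nonneg[of "lebesgue_on \<Omega>" "weak_grad \<Omega> v"] by simp
qed

text \<open>
  With \<open>\<epsilon>\<close> for the strain, coercivity and Cauchy--Schwarz give
  \<open>\<alpha> \<parallel>\<epsilon> v\<parallel>\<^sup>2 \<le> \<parallel>f\<parallel> \<parallel>v\<parallel> \<le> \<parallel>f\<parallel> H C \<parallel>\<nabla>v\<parallel>\<close>, and Korn's inequality bounds \<open>\<parallel>\<nabla>v\<parallel>\<^sup>2\<close> by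
  \<open>Cko\<^sup>2 \<parallel>\<epsilon> v\<parallel>\<^sup>2\<close>; one factor \<open>\<parallel>\<nabla>v\<parallel>\<close> cancels. The \<open>L\<^sub>2\<close> part of the norm is again controlled by
  \<open>H C \<parallel>\<nabla>v\<parallel>\<close>, and the upper bound \<open>D\<close> of \<open>H\<close> keeps the final constant independent of \<open>H\<close>.
\<close>

lemma (in elasticity) fine_scale_h1_bound:
  assumes korn: "korn_constant \<Omega> V Cko" and v: "v \<in> V" "v \<in> H1 \<Omega>" and f: "L2 (lebesgue_on \<Omega>) f"
    and energy: "elastic_form \<Omega> A v v = l2_inner (lebesgue_on \<Omega>) f v"
    and approx: "l2_norm (lebesgue_on \<Omega>) v \<le> H * C * l2_norm (lebesgue_on \<Omega>) (weak_grad \<Omega> v)"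
    and H: "0 \<le> H" "H \<le> D" and C: "0 \<le> C"
  shows "h1_norm \<Omega> v \<le> (1 + D * C) * Cko\<^sup>2 * C * H * inverse \<alpha> * l2_norm (lebesgue_on \<Omega>) f"
proof -
  define s where "s = l2_norm (lebesgue_on \<Omega>) (strain \<Omega> v)"
  define n where "n = l2_norm (lebesgue_on \<Omega>) (weak_grad \<Omega> v)"
  define p where "p = l2_norm (lebesgue_on \<Omega>) v"
  define q where "q = l2_norm (lebesgue_on \<Omega>) f"
  have nonneg: "0 \<le> s" "0 \<le> n" "0 \<le> p" "0 \<le> q" by (simp_all add: s_def n_def p_def q_def)
  have "\<alpha> * s\<^sup>2 \<le> q * p"
    using elastic_form_coercive[OF v(2)] energy l2_inner_le[OF f H1_L2[OF v(2)]]
    by (simp add: s_def q_def p_def)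
  also have "\<dots> \<le> q * (H * C * n)" using approx nonneg by (intro mult_left_mono) (auto simp: p_def n_def)
  finally have "s\<^sup>2 \<le> inverse \<alpha> * (q * (H * C * n))" using \<alpha>_pos by (simp add: field_simps)
  then have "Cko\<^sup>2 * s\<^sup>2 \<le> Cko\<^sup>2 * (inverse \<alpha> * (q * (H * C * n)))" by (intro mult_left_mono) auto
  moreover have "n \<le> Cko * s" using korn v(1) by (simp add: korn_constant_def n_def s_def)
  then have "n\<^sup>2 \<le> (Cko * s)\<^sup>2" using nonneg by (intro power_mono)
  ultimately have "n * n \<le> (Cko\<^sup>2 * C * H * inverse \<alpha> * q) * n"
    by (simp add: power_mult_distrib power2_eq_square mult_ac)
  moreover have K: "0 \<le> Cko\<^sup>2 * C * H * inverse \<alpha> * q"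
    using nonneg H C \<alpha>_pos by simp
  ultimately have n: "n \<le> Cko\<^sup>2 * C * H * inverse \<alpha> * q"
    using nonneg by (cases "n = 0") auto
  have "h1_norm \<Omega> v \<le> p + n"
    unfolding h1_norm_def p_def n_def by (intro sqrt_sum_squares_le_sum) auto
  also have "\<dots> \<le> H * C * n + n" using approx by (simp add: p_def n_def)
  also have "\<dots> \<le> (1 + D * C) * n"
    using mult_right_mono[OF mult_right_mono[OF H(2) C] nonneg(2)] by (simp add: algebra_simps)
  also have "\<dots> \<le> (1 + D * C) * (Cko\<^sup>2 * C * H * inverse \<alpha> * q)"
    using n H C by (intro mult_left_mono) auto
  finally show ?thesis by (simp add: q_def mult_ac)
qed

text \<open>
  On the kernel of \<open>J\<close> the interpolation error is the function itself. The absolute value spares a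
  hypothesis on the sign of \<open>C\<close>.
\<close>

lemma fine_space_l2_bound:
  assumes "global_interpolation_constant \<Omega> H Vh J C" "v \<in> fine_space Vh J" "0 < H"
  shows "l2_norm (lebesgue_on \<Omega>) v \<le> H * \<bar>C\<bar> * l2_norm (lebesgue_on \<Omega>) (weak_grad \<Omega> v)"
proof -
  have v: "v \<in> Vh" "J v = (\<lambda>x. 0)" using assms(2) by (auto simp: fine_space_def)
  let ?n = "l2_norm (lebesgue_on \<Omega>)"
  have "inverse H * ?n (\<lambda>x. v x - J v x) + ?n (weak_grad \<Omega> (J v)) \<le> C * ?n (weak_grad \<Omega> v)"
    using assms(1) v(1) unfolding global_interpolation_constant_def by blast
  then have "inverse H * ?n v \<le> C * ?n (weak_grad \<Omega> v)"
    using l2_norm_nonneg[of "lebesgue_on \<Omega>" "weak_grad \<Omega> (\<lambda>x. 0)"] unfolding v(2) diff_zero by linarith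
  also have "\<dots> \<le> \<bar>C\<bar> * ?n (weak_grad \<Omega> v)" by (intro mult_right_mono) auto
  finally show ?thesis using assms(3) by (simp add: field_simps)
qed

theorem lemma3p2:
  fixes \<Omega> \<Gamma>D \<Gamma>N :: "(real^'n) set"
    and \<gamma> :: "(real^'n \<Rightarrow> real^'n) \<Rightarrow> real^'n \<Rightarrow> real^'n"
  assumes dim: "CARD('n) \<in> {2, 3}"
    and domain: "polyhedral_lipschitz_domain \<Omega>"
    and boundary: "frontier \<Omega> = \<Gamma>D \<union> \<Gamma>N" "\<Gamma>D \<inter> \<Gamma>N = {}"
      "\<Gamma>D \<in> sets surface_measure" "\<Gamma>N \<in> sets surface_measure"
      "emeasure surface_measure \<Gamma>D > 0"
    and trace: "trace_operator \<Omega> \<Gamma>D \<gamma>"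
  shows "\<exists>C :: real \<Rightarrow> real \<Rightarrow> real.
    \<forall>Cko C\<rho> CI \<alpha> \<beta> (A :: real^'n \<Rightarrow> 'n tensor4)
      (f :: real^'n \<Rightarrow> real^'n) (b :: real^'n \<Rightarrow> real^'n) (g :: real^'n \<Rightarrow> real^'n)
      (\<F>h :: (real^'n) set set set) (\<F>H :: (real^'n) set set set) \<T>h \<T>H h H
      Sh Vh VH J Vf R (gh :: real^'n \<Rightarrow> real^'n) bf uh ums.
      korn_constant \<Omega> (H1_zero \<Omega> \<Gamma>D \<gamma>) Cko \<longrightarrow>
      elasticity_tensor \<Omega> A \<alpha> \<beta> \<longrightarrow>
      L2 (lebesgue_on \<Omega>) f \<longrightarrow> L2 (surface_on \<Gamma>N) b \<longrightarrow> g \<in> H_half \<Omega> \<Gamma>D \<gamma> \<longrightarrow>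
      (\<forall>\<T>\<in>\<F>h \<union> \<F>H. mesh \<Omega> \<T>) \<longrightarrow>
      shape_regular_family \<F>h \<longrightarrow> shape_regular_family \<F>H \<longrightarrow> quasi_uniform_family \<F>H \<longrightarrow>
      \<T>h \<in> \<F>h \<longrightarrow> \<T>H \<in> \<F>H \<longrightarrow> refines_mesh \<T>h \<T>H \<longrightarrow>
      h = mesh_size \<T>h \<longrightarrow> H = mesh_size \<T>H \<longrightarrow> h < H \<longrightarrow>
      Sh = affine_fe \<Omega> \<T>h \<longrightarrow>
      Vh = Sh \<inter> H1_zero \<Omega> \<Gamma>D \<gamma> \<longrightarrow>
      VH = affine_fe \<Omega> \<T>H \<inter> H1_zero \<Omega> \<Gamma>D \<gamma> \<longrightarrow>
      interpolation_operator \<Omega> \<T>H Vh VH J CI \<longrightarrow>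
      global_interpolation_constant \<Omega> H Vh J C\<rho> \<longrightarrow>
      Vf = fine_space Vh J \<longrightarrow>
      gh \<in> Sh \<longrightarrow> (\<forall>z\<in>mesh_nodes \<T>h - \<Gamma>D. gh z = 0) \<longrightarrow>
      reference_solution \<Omega> \<Gamma>N A f b Vh gh uh \<longrightarrow>
      fine_corrector \<Omega> A Sh Vf R \<longrightarrow>
      neumann_corrector \<Omega> \<Gamma>N A b Vf bf \<longrightarrow>
      ideal_solution \<Omega> \<Gamma>N A f b VH R bf gh ums \<longrightarrow>
      h1_norm \<Omega> (\<lambda>x. uh x - ums x) \<le> C Cko C\<rho> * H * inverse \<alpha> * l2_norm (lebesgue_on \<Omega>) f"
proof -
  interpret bounded_open_set \<Omega>
    using domain by unfold_locales (auto simp: polyhedral_lipschitz_domain_def)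
  have \<Omega>: "connected \<Omega>" "\<Omega> \<noteq> {}" "bounded \<Omega>"
    using domain by (auto simp: polyhedral_lipschitz_domain_def)
  have \<Gamma>D: "\<Gamma>D \<subseteq> closure \<Omega>" using boundary(1) by (auto simp: frontier_def)
  \<comment> \<open>The mesh size is at most the diameter of the domain, which therefore may enter the constant.\<close>
  define C where "C Cko C\<rho> = (1 + diameter (closure \<Omega>) * \<bar>C\<rho>\<bar>) * Cko\<^sup>2 * \<bar>C\<rho>\<bar>" for Cko C\<rho> :: real
  show ?thesis
  proof (intro exI[of _ C] allI impI)
    fix Cko C\<rho> CI \<alpha> \<beta> :: real and A :: "real^'n \<Rightarrow> 'n tensor4"
      and f b g :: "real^'n \<Rightarrow> real^'n" and \<F>h \<F>H :: "(real^'n) set set set"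
      and \<T>h \<T>H :: "(real^'n) set set" and h H :: real and Sh Vh VH :: "(real^'n \<Rightarrow> real^'n) set"
      and J :: "(real^'n \<Rightarrow> real^'n) \<Rightarrow> real^'n \<Rightarrow> real^'n" and Vf :: "(real^'n \<Rightarrow> real^'n) set"
      and R :: "(real^'n \<Rightarrow> real^'n) \<Rightarrow> real^'n \<Rightarrow> real^'n" and gh bf uh ums :: "real^'n \<Rightarrow> real^'n"
    assume korn: "korn_constant \<Omega> (H1_zero \<Omega> \<Gamma>D \<gamma>) Cko" and tensor: "elasticity_tensor \<Omega> A \<alpha> \<beta>"
      and f: "L2 (lebesgue_on \<Omega>) f"
      and meshes: "\<forall>\<T>\<in>\<F>h \<union> \<F>H. mesh \<Omega> \<T>" "\<T>h \<in> \<F>h" "\<T>H \<in> \<F>H" "refines_mesh \<T>h \<T>H"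
      and h: "h = mesh_size \<T>h" "H = mesh_size \<T>H" "h < H"
      and Sh: "Sh = affine_fe \<Omega> \<T>h" and Vh: "Vh = Sh \<inter> H1_zero \<Omega> \<Gamma>D \<gamma>"
      and VH: "VH = affine_fe \<Omega> \<T>H \<inter> H1_zero \<Omega> \<Gamma>D \<gamma>"
      and J: "interpolation_operator \<Omega> \<T>H Vh VH J CI"
      and C\<rho>: "global_interpolation_constant \<Omega> H Vh J C\<rho>"
      and Vf: "Vf = fine_space Vh J" and gh: "gh \<in> Sh"
      and uh: "reference_solution \<Omega> \<Gamma>N A f b Vh gh uh"
      and R: "fine_corrector \<Omega> A Sh Vf R" and bf: "neumann_corrector \<Omega> \<Gamma>N A b Vf bf"
      and ums: "ideal_solution \<Omega> \<Gamma>N A f b VH R bf gh ums"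
    have mesh: "mesh \<Omega> \<T>h" "mesh \<Omega> \<T>H" using meshes by blast+
    interpret triangulated_domain \<Omega> \<T>h by (rule mesh_triangulated_domain[OF mesh(1)])
    interpret elasticity \<Omega> A \<alpha> \<beta> by unfold_locales (rule tensor)
    have H: "0 < H" "H \<le> diameter (closure \<Omega>)"
      using mesh_size_bounds[OF mesh(1) \<Omega>(2,3)] mesh_size_bounds[OF mesh(2) \<Omega>(2,3)] h by auto
    have Vh_sub: "function_subspace Vh"
      unfolding Vh Sh by (intro function_subspace_Int function_subspace_affine_fe function_subspace_H1_zero trace)
    obtain u0 where u0: "u0 \<in> Vh" "uh = (\<lambda>x. u0 x + gh x)"
      "\<And>v. v \<in> Vh \<Longrightarrow> elastic_form \<Omega> A u0 v = load \<Omega> \<Gamma>N f b v - elastic_form \<Omega> A gh v"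
      using uh unfolding reference_solution_def by blast
    obtain um where um: "um \<in> multiscale_space VH R" "ums = (\<lambda>x. um x + bf x + gh x - R gh x)"
      "\<And>v. v \<in> multiscale_space VH R \<Longrightarrow> elastic_form \<Omega> A um v =
          load \<Omega> \<Gamma>N f b v - elastic_form \<Omega> A (\<lambda>x. bf x + gh x - R gh x) v"
      using ums unfolding ideal_solution_def by blast
    define e where "e = (\<lambda>x. u0 x - um x - bf x + R gh x)"
    obtain ef em where dec: "ef \<in> fine_space Vh J" "em \<in> Vh" "e = (\<lambda>x. ef x + em x)"
      "elastic_form \<Omega> A em em = 0"
      "\<And>w. w \<in> fine_space Vh J \<Longrightarrow> elastic_form \<Omega> A e w = l2_inner (lebesgue_on \<Omega>) f w"
      unfolding e_def
    proof (rule ideal_error_decomposition[of "H1 \<Omega>" "elastic_form \<Omega> A" Sh Vh VH J R gh u0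
          "l2_inner (lebesgue_on \<Omega>) f" "l2_inner (surface_on \<Gamma>N) b" bf um])
      show "symmetric_bilinear_form (H1 \<Omega>) (elastic_form \<Omega> A)" by (rule form.symmetric_bilinear_form_axioms)
      show "Sh \<subseteq> H1 \<Omega>" unfolding Sh using affine_fe_H1 by blast
      show "Vh \<subseteq> Sh" unfolding Vh by blast
      show "VH \<subseteq> Vh" unfolding VH Vh Sh using affine_fe_refinement[OF meshes(4)] by blast
      show "linear_between Vh VH J" "\<And>v. v \<in> Vh \<Longrightarrow> J (J v) = J v"
        using J by (auto simp: interpolation_operator_def)
      show "\<And>v. v \<in> Sh \<Longrightarrow> R v \<in> fine_space Vh J"
        "\<And>v w. v \<in> Sh \<Longrightarrow> w \<in> fine_space Vh J \<Longrightarrow> elastic_form \<Omega> A (R v) w = elastic_form \<Omega> A v w"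
        using R by (auto simp: fine_corrector_def Vf)
      show "bf \<in> fine_space Vh J"
        "\<And>w. w \<in> fine_space Vh J \<Longrightarrow> elastic_form \<Omega> A bf w = l2_inner (surface_on \<Gamma>N) b w"
        using bf by (auto simp: neumann_corrector_def Vf)
    qed (use Vh_sub gh u0 um in \<open>auto simp: load_def\<close>)
    have em: "em \<in> affine_fe \<Omega> \<T>h" "em \<in> H1_zero \<Omega> \<Gamma>D \<gamma>" using dec(2) Vh Sh by auto
    have "AE x in lebesgue_on \<Omega>. weak_grad \<Omega> em x = 0"
      by (rule weak_grad_AE_0_if_energy_0[OF korn em(2) affine_fe_H1[OF em(1)] dec(4)])
    then have "em constant_on closure \<Omega>"
      using mesh(1) simplex_interior_nonempty
      by (intro affine_fe_constant[OF em(1) \<Omega>(1)]) (auto simp: mesh_def)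
    \<comment> \<open>A constant has energy zero as well; the Dirichlet condition excludes the nonzero ones.\<close>
    then have "em = (\<lambda>x. 0)"
      using affine_fe_H1_zero_eq_0[OF em _ trace \<Gamma>D boundary(3,5)] by blast
    then have e: "e \<in> fine_space Vh J" using dec(1,3) by simp
    then have e_Vh: "e \<in> affine_fe \<Omega> \<T>h" "e \<in> H1_zero \<Omega> \<Gamma>D \<gamma>"
      by (auto simp: fine_space_def Vh Sh)
    have "h1_norm \<Omega> e \<le> (1 + diameter (closure \<Omega>) * \<bar>C\<rho>\<bar>) * Cko\<^sup>2 * \<bar>C\<rho>\<bar> * H * inverse \<alpha> * l2_norm (lebesgue_on \<Omega>) f"
      using H by (intro fine_scale_h1_bound[OF korn e_Vh(2) affine_fe_H1[OF e_Vh(1)] f dec(5)[OF e]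
          fine_space_l2_bound[OF C\<rho> e H(1)]]) auto
    moreover have "(\<lambda>x. uh x - ums x) = e"
      by (simp add: u0(2) um(2) e_def algebra_simps)
    ultimately show "h1_norm \<Omega> (\<lambda>x. uh x - ums x) \<le> C Cko C\<rho> * H * inverse \<alpha> * l2_norm (lebesgue_on \<Omega>) f"
      by (simp add: C_def)
  qed
qed

end
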